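(* Let $G$ be a complex Lie group and let $F$ be a left invariant complex Finsler metric on $G$. Then the holomorphic sectional curvature $K$ of $F$ vanishes identically on $T^{1,0}G\setminus 0$.
   Context: Conventions: repeated indices are summed. $M$ is a complex manifold of complex dimension $n>0$; for a holomorphic local coordinate $z=(z^1,\dots,z^n)$ on $M$, $(z,w)=(z^1,\dots,z^n,w^1,\dots,w^n)$ denotes the induced holomorphic coordinate on the holomorphic tangent bundle $T^{1,0}M$, representing $w^i\partial_{z^i}\in T^{1,0}_zM$. $T^{1,0}M\setminus 0$ is the complement of the zero section. A complex Finsler metric on $M$ is a continuous function $F:T^{1,0}M\to[0,+\infty)$ such that: (1) $F$ is positive and smooth on $T^{1,0}M\setminus 0$; (2) $F(z,\lambda w)=|\lambda|F(z,w)$ for all $(z,w)\in T^{1,0}M$, $\lambda\in\mathbb{C}$; (3) (pseudo-convexity) with $\mathrm{G}=F^2$, the complex Hessian $(\mathrm{G}_{i\overline{j}})=(\partial_{w^i}\partial_{\overline{w}^j}\mathrm{G})$ is positive definite at every point of $T^{1,0}M\setminus 0$. $(\mathrm{G}^{\overline{i}j})$ is the inverse matrix: $\mathrm{G}_{k\overline{j}}\mathrm{G}^{\overline{j}i}=\delta^i_k$. The holomorphic sectional curvature is the function on $T^{1,0}M\setminus0$ $$K=2R_{i\overline{j}k\overline{l}}\frac{w^i\overline{w}^jw^k\overline{w}^l}{\mathrm{G}^2},\qquad R_{i\overline{j}k\overline{l}}=-\partial_{z^k}\partial_{\overline{z}^l}\mathrm{G}_{i\overline{j}}+\mathrm{G}^{\overline{q}p}\,\partial_{z^k}\mathrm{G}_{i\overline{q}}\,\partial_{\overline{z}^l}\mathrm{G}_{p\overline{j}}.$$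 A complex Lie group is a complex manifold with a group structure whose multiplication and inversion are holomorphic. A complex Finsler metric $F$ on $G$ is left invariant if $F((L_g)_*w)=F(w)$ for all $g\in G$ and $w\in T^{1,0}G$, where $L_g(g')=gg'$. *)

theory Defs
  imports "HOL-Analysis.Analysis" "HOL-Algebra.Group"
begin

section \<open>Calculus on \<open>\<complex>\<^sup>n\<close>\<close>

text \<open>Holomorphy in several variables: Frechet differentiability over the reals with a
  complex linear derivative. It is only used on open sets.\<close>

definition holo_on ::
    "(complex^'m::finite) set \<Rightarrow> (complex^'m \<Rightarrow> complex^'n::finite) \<Rightarrow> bool" where
  "holo_on S f \<longleftrightarrow>
     (\<forall>x\<in>S. \<exists>f'. (f has_derivative f') (at x) \<and> (\<forall>a v. f' (a *s v) = a *s f' v))"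

primrec C_k_on ::
    "nat \<Rightarrow> 'a::real_normed_vector set \<Rightarrow> ('a \<Rightarrow> 'b::real_normed_vector) \<Rightarrow> bool" where
  "C_k_on 0 S f \<longleftrightarrow> continuous_on S f"
| "C_k_on (Suc k) S f \<longleftrightarrow>
     (\<forall>x\<in>S. f differentiable (at x)) \<and>
     (\<forall>v. C_k_on k S (\<lambda>x. frechet_derivative f (at x) v))"

definition smooth_on ::
    "'a::real_normed_vector set \<Rightarrow> ('a \<Rightarrow> 'b::real_normed_vector) \<Rightarrow> bool" where
  "smooth_on S f \<longleftrightarrow> (\<forall>k. C_k_on k S f)"

text \<open>The Wirtinger derivatives \<open>\<partial>/\<partial>z\<^sup>i = (\<partial>/\<partial>x\<^sup>i - \<i> \<partial>/\<partial>y\<^sup>i)/2\<close> and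
  \<open>\<partial>/\<partial>(conjugate of z\<^sup>i) = (\<partial>/\<partial>x\<^sup>i + \<i> \<partial>/\<partial>y\<^sup>i)/2\<close>.\<close>

definition wirt :: "'n::finite \<Rightarrow> (complex^'n \<Rightarrow> complex) \<Rightarrow> complex^'n \<Rightarrow> complex" where
  "wirt i f z = (frechet_derivative f (at z) (axis i 1)
                 - \<i> * frechet_derivative f (at z) (axis i \<i>)) / 2"

definition wirt_bar :: "'n::finite \<Rightarrow> (complex^'n \<Rightarrow> complex) \<Rightarrow> complex^'n \<Rightarrow> complex" where
  "wirt_bar i f z = (frechet_derivative f (at z) (axis i 1)
                     + \<i> * frechet_derivative f (at z) (axis i \<i>)) / 2"

definition pos_def :: "complex^'n^'n::finite \<Rightarrow> bool" where
  "pos_def H \<longleftrightarrow>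
     (\<forall>i j. H $ i $ j = cnj (H $ j $ i)) \<and>
     (\<forall>v. v \<noteq> 0 \<longrightarrow> 0 < Re (\<Sum>i\<in>UNIV. \<Sum>j\<in>UNIV. H $ i $ j * v $ i * cnj (v $ j)))"

section \<open>Complex manifolds\<close>

text \<open>The map of a chart is only meaningful on the domain of the chart.\<close>

datatype ('a, 'n) chart = Chart (dom: "'a set") (coord: "'a \<Rightarrow> complex^'n")

abbreviation codom :: "('a, 'n::finite) chart \<Rightarrow> (complex^'n) set" where
  "codom c \<equiv> coord c ` dom c"

definition inv_coord :: "('a, 'n::finite) chart \<Rightarrow> complex^'n \<Rightarrow> 'a" where
  "inv_coord c = inv_into (dom c) (coord c)"

definition is_chart :: "'a topology \<Rightarrow> ('a, 'n::finite) chart \<Rightarrow> bool" where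
  "is_chart X c \<longleftrightarrow>
     openin X (dom c) \<and> open (codom c) \<and>
     homeomorphic_map (subtopology X (dom c)) (top_of_set (codom c)) (coord c)"

definition compatible :: "('a, 'n::finite) chart \<Rightarrow> ('a, 'n) chart \<Rightarrow> bool" where
  "compatible c d \<longleftrightarrow>
     holo_on (coord c ` (dom c \<inter> dom d)) (coord d \<circ> inv_coord c) \<and>
     holo_on (coord d ` (dom c \<inter> dom d)) (coord c \<circ> inv_coord d)"

text \<open>The complex dimension is the cardinality of the index type \<open>'n\<close>, hence positive. The atlas
  \<open>A\<close> is maximal, so its elements are exactly the holomorphic local coordinates of the manifold.\<close>

locale complex_manifold =
  fixes X :: "'a topology" and A :: "('a, 'n::finite) chart set"
  assumes Hausdorff: "Hausdorff_space X"
    and second_countable: "\<exists>B. countable B \<and> openin X = arbitrary union_of (\<lambda>U. U \<in> B)"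
    and charts: "c \<in> A \<Longrightarrow> is_chart X c"
    and cover: "topspace X = (\<Union>c\<in>A. dom c)"
    and compat: "c \<in> A \<Longrightarrow> d \<in> A \<Longrightarrow> compatible c d"
    and maximal: "is_chart X c \<Longrightarrow> (\<And>d. d \<in> A \<Longrightarrow> compatible c d) \<Longrightarrow> c \<in> A"

text \<open>A possibly non-maximal atlas suffices in the definition of holomorphic maps.\<close>

definition holomorphic_map ::
    "'a topology \<Rightarrow> ('a, 'm::finite) chart set \<Rightarrow> 'b topology \<Rightarrow> ('b, 'n::finite) chart set
     \<Rightarrow> ('a \<Rightarrow> 'b) \<Rightarrow> bool" where
  "holomorphic_map X A Y B f \<longleftrightarrow>
     continuous_map X Y f \<and>
     (\<forall>c\<in>A. \<forall>d\<in>B. holo_on (coord c ` {p \<in> dom c. f p \<in> dom d})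
                          (coord d \<circ> f \<circ> inv_coord c))"

text \<open>The atlas of all products of charts, with model space \<open>\<complex>\<^sup>m\<^sup>+\<^sup>n\<close>; it generates the
  product complex structure.\<close>

definition prod_chart ::
    "('a, 'm::finite) chart \<Rightarrow> ('b, 'n::finite) chart \<Rightarrow> ('a \<times> 'b, 'm + 'n) chart" where
  "prod_chart c d =
     Chart (dom c \<times> dom d)
           (\<lambda>(p, q). \<chi> k. case k of Inl i \<Rightarrow> coord c p $ i | Inr j \<Rightarrow> coord d q $ j)"

definition prod_atlas ::
    "('a, 'm::finite) chart set \<Rightarrow> ('b, 'n::finite) chart set \<Rightarrow> ('a \<times> 'b, 'm + 'n) chart set" where
  "prod_atlas A B = {prod_chart c d | c d. c \<in> A \<and> d \<in> B}"

section \<open>The holomorphic tangent bundle\<close>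

text \<open>A holomorphic tangent vector \<open>v\<close> at \<open>p\<close> is given by its components in all charts around
  \<open>p\<close>, related by the Jacobians of the coordinate changes: \<open>v c\<close> stands for the coefficients
  \<open>w\<^sup>i\<close> of \<open>w\<^sup>i \<partial>/\<partial>z\<^sup>i\<close> in the coordinate \<open>z = coord c\<close>. The value at charts not around \<open>p\<close>
  is fixed to be \<open>0\<close>.\<close>

type_synonym ('a, 'n) tvec = "('a, 'n) chart \<Rightarrow> complex^'n"

definition tangent_space :: "('a, 'n::finite) chart set \<Rightarrow> 'a \<Rightarrow> ('a, 'n) tvec set" where
  "tangent_space A p = {v.
     (\<forall>c. \<not> (c \<in> A \<and> p \<in> dom c) \<longrightarrow> v c = 0) \<and>
     (\<forall>c\<in>A. \<forall>d\<in>A. p \<in> dom c \<inter> dom d \<longrightarrow>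
        v d = frechet_derivative (coord d \<circ> inv_coord c) (at (coord c p)) (v c))}"

definition tangent_bundle ::
    "'a topology \<Rightarrow> ('a, 'n::finite) chart set \<Rightarrow> ('a \<times> ('a, 'n) tvec) set" where
  "tangent_bundle X A = (SIGMA p:topspace X. tangent_space A p)"

text \<open>The complement of the zero section.\<close>

definition slit_tangent_bundle ::
    "'a topology \<Rightarrow> ('a, 'n::finite) chart set \<Rightarrow> ('a \<times> ('a, 'n) tvec) set" where
  "slit_tangent_bundle X A = {(p, v) \<in> tangent_bundle X A. v \<noteq> (\<lambda>_. 0)}"

text \<open>The element of the tangent bundle with induced coordinates \<open>(z, w)\<close> in the chart \<open>c\<close>.\<close>

definition of_coords ::
    "('a, 'n::finite) chart set \<Rightarrow> ('a, 'n) chart \<Rightarrow> complex^'n \<Rightarrow> complex^'n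
     \<Rightarrow> 'a \<times> ('a, 'n) tvec" where
  "of_coords A c z w =
     (inv_coord c z,
      \<lambda>d. if d \<in> A \<and> inv_coord c z \<in> dom d
          then frechet_derivative (coord d \<circ> inv_coord c) (at z) w else 0)"

text \<open>The map \<open>f\<^sub>*\<close> induced by a holomorphic \<open>f\<close> from a manifold with atlas \<open>A\<close> to one with
  atlas \<open>B\<close>. By the chain rule the result does not depend on the chosen chart around \<open>p\<close>.\<close>

definition pushforward ::
    "('a, 'm::finite) chart set \<Rightarrow> ('b, 'n::finite) chart set \<Rightarrow> ('a \<Rightarrow> 'b)
     \<Rightarrow> 'a \<times> ('a, 'm) tvec \<Rightarrow> 'b \<times> ('b, 'n) tvec" where
  "pushforward A B f = (\<lambda>(p, v).
     let c = (SOME c. c \<in> A \<and> p \<in> dom c)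
     in (f p, \<lambda>d. if d \<in> B \<and> f p \<in> dom d
                  then frechet_derivative (coord d \<circ> f \<circ> inv_coord c) (at (coord c p)) (v c)
                  else 0))"

section \<open>Complex Finsler metrics and their curvature\<close>

text \<open>In the following three definitions \<open>\<GG>\<close> is the function \<open>(z, w) \<mapsto> F(z, w)\<^sup>2\<close> in induced
  coordinates. The entry of \<open>hess\<close> at \<open>i, j\<close> is \<open>\<GG>\<^sub>i\<^sub>j\<close> with \<open>j\<close> the conjugated index, and the
  entry of its inverse matrix at \<open>q, p\<close> is the one with \<open>q\<close> conjugated, so that
  \<open>hess ** matrix_inv hess = mat 1\<close>.\<close>

definition hess ::
    "(complex^'n \<Rightarrow> complex^'n \<Rightarrow> complex) \<Rightarrow> complex^'n \<Rightarrow> complex^'n \<Rightarrow> complex^'n^'n::finite" where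
  "hess \<GG> z w = (\<chi> i j. wirt i (wirt_bar j (\<GG> z)) w)"

definition curv ::
    "(complex^'n::finite \<Rightarrow> complex^'n \<Rightarrow> complex) \<Rightarrow> complex^'n \<Rightarrow> complex^'n
     \<Rightarrow> 'n \<Rightarrow> 'n \<Rightarrow> 'n \<Rightarrow> 'n \<Rightarrow> complex" where
  "curv \<GG> z w i j k l =
     - wirt k (wirt_bar l (\<lambda>z. hess \<GG> z w $ i $ j)) z
     + (\<Sum>q\<in>UNIV. \<Sum>p\<in>UNIV. matrix_inv (hess \<GG> z w) $ q $ p
          * wirt k (\<lambda>z. hess \<GG> z w $ i $ q) z
          * wirt_bar l (\<lambda>z. hess \<GG> z w $ p $ j) z)"

definition hol_sect_curv_coord ::
    "(complex^'n::finite \<Rightarrow> complex^'n \<Rightarrow> complex) \<Rightarrow> complex^'n \<Rightarrow> complex^'n \<Rightarrow> complex" where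
  "hol_sect_curv_coord \<GG> z w =
     2 * (\<Sum>i\<in>UNIV. \<Sum>j\<in>UNIV. \<Sum>k\<in>UNIV. \<Sum>l\<in>UNIV.
            curv \<GG> z w i j k l * (w $ i * cnj (w $ j) * w $ k * cnj (w $ l)) / (\<GG> z w)\<^sup>2)"

definition sq_coord ::
    "('a, 'n::finite) chart set \<Rightarrow> ('a \<times> ('a, 'n) tvec \<Rightarrow> real) \<Rightarrow> ('a, 'n) chart
     \<Rightarrow> complex^'n \<Rightarrow> complex^'n \<Rightarrow> complex" where
  "sq_coord A F c z w = complex_of_real ((F (of_coords A c z w))\<^sup>2)"

text \<open>Continuity and smoothness on the tangent bundle, and the complex Hessian, are expressed in
  the induced coordinates of every chart. Values of \<open>F\<close> off the tangent bundle are irrelevant.\<close>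

definition complex_finsler_metric ::
    "'a topology \<Rightarrow> ('a, 'n::finite) chart set \<Rightarrow> ('a \<times> ('a, 'n) tvec \<Rightarrow> real) \<Rightarrow> bool" where
  "complex_finsler_metric X A F \<longleftrightarrow>
     (\<forall>x \<in> tangent_bundle X A. 0 \<le> F x) \<and>
     (\<forall>c\<in>A. continuous_on (codom c \<times> UNIV) (\<lambda>(z, w). F (of_coords A c z w))) \<and>
     (\<forall>x \<in> slit_tangent_bundle X A. 0 < F x) \<and>
     (\<forall>c\<in>A. smooth_on (codom c \<times> (- {0})) (\<lambda>(z, w). F (of_coords A c z w))) \<and>
     (\<forall>(p, v) \<in> tangent_bundle X A. \<forall>a::complex. F (p, \<lambda>c. a *s v c) = cmod a * F (p, v)) \<and>
     (\<forall>c\<in>A. \<forall>z \<in> codom c. \<forall>w. w \<noteq> 0 \<longrightarrow> pos_def (hess (sq_coord A F c) z w))"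

text \<open>The holomorphic sectional curvature at a nonzero tangent vector, computed in the coordinate
  \<open>c\<close> around its base point.\<close>

definition hol_sect_curv ::
    "('a, 'n::finite) chart set \<Rightarrow> ('a \<times> ('a, 'n) tvec \<Rightarrow> real) \<Rightarrow> ('a, 'n) chart
     \<Rightarrow> 'a \<times> ('a, 'n) tvec \<Rightarrow> complex" where
  "hol_sect_curv A F c = (\<lambda>(p, v). hol_sect_curv_coord (sq_coord A F c) (coord c p) (v c))"

section \<open>Complex Lie groups\<close>

locale complex_lie_group = complex_manifold X A + group G
  for X :: "'a topology" and A :: "('a, 'n::finite) chart set"
    and G :: "('a, 'b) monoid_scheme" (structure) +
  assumes carrier: "carrier G = topspace X"
    and mult_holomorphic:
      "holomorphic_map (prod_topology X X) (prod_atlas A A) X A (\<lambda>(g, h). g \<otimes> h)"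
    and inv_holomorphic: "holomorphic_map X A X A (\<lambda>g. inv g)"

definition left_invariant ::
    "'a topology \<Rightarrow> ('a, 'n::finite) chart set \<Rightarrow> ('a, 'b) monoid_scheme
     \<Rightarrow> ('a \<times> ('a, 'n) tvec \<Rightarrow> real) \<Rightarrow> bool" where
  "left_invariant X A G F \<longleftrightarrow>
     (\<forall>g \<in> carrier G. \<forall>x \<in> tangent_bundle X A.
        F (pushforward A A (\<lambda>h. g \<otimes>\<^bsub>G\<^esub> h) x) = F x)"

end

theory Submission
  imports Defs "HOL-Complex_Analysis.Cauchy_Integral_Formula"
begin

text \<open>In a chart around \<open>p\<close> with coordinate \<open>z\<^sub>0\<close> let \<open>B z\<close> be the differential at \<open>z\<close> of the left
  translation taking \<open>z\<close> to \<open>p\<close>. It depends holomorphically on \<open>z\<close>, being a partial derivative of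
  the holomorphic map \<open>(z, x) \<mapsto> p z\<^sup>-\<^sup>1 x\<close>, and left invariance says \<open>\<GG>(z, w) = f (B z w)\<close> with
  \<open>f = \<GG>(z\<^sub>0, -)\<close>. By homogeneity, contracting the curvature with \<open>w\<close> turns \<open>\<GG>\<^sub>i\<^sub>j w\<^sup>i\<close> into
  \<open>\<GG>\<^sub>j\<close> (\<open>j\<close> conjugated), so only first \<open>w\<close>-derivatives of \<open>\<GG>\<close> have to be differentiated in \<open>z\<close>.
  As \<open>B\<close> is holomorphic with \<open>B z\<^sub>0 = id\<close>, both terms of the curvature are then, up to sign, the
  complex Hessian of \<open>f\<close> on the vector \<open>W\<close>, the derivative of \<open>B z w\<close> in the direction \<open>w\<close>,
  and they cancel.\<close>

section \<open>Wirtinger derivatives\<close>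

text \<open>\<open>L\<close> is only real linear, so the expansion runs over the real basis formed
  by the vectors \<open>axis m 1\<close> and \<open>axis m \<i>\<close>.\<close>

lemma linear_eq_sum_axis:
  fixes L :: "complex^'n::finite \<Rightarrow> 'b::real_vector"
  assumes "linear L"
  shows "L y = (\<Sum>m\<in>UNIV. Re (y $ m) *\<^sub>R L (axis m 1) + Im (y $ m) *\<^sub>R L (axis m \<i>))"
proof -
  have y: "y = (\<Sum>m\<in>UNIV. Re (y $ m) *\<^sub>R axis m 1 + Im (y $ m) *\<^sub>R axis m \<i>)"
  proof (rule vec_eq_iff[THEN iffD2], rule)
    fix i
    have *: "(Re (y $ m) *\<^sub>R axis m 1 + Im (y $ m) *\<^sub>R axis m \<i>) $ i = (if m = i then y $ m else 0)" for m
      by (auto simp: axis_def complex_eq_iff)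
    show "y $ i = (\<Sum>m\<in>UNIV. Re (y $ m) *\<^sub>R axis m 1 + Im (y $ m) *\<^sub>R axis m \<i>) $ i"
      unfolding sum_component * by simp
  qed
  show ?thesis
    by (subst y) (simp add: linear_sum[OF assms] linear_add[OF assms] linear_scale[OF assms])
qed

text \<open>The right-hand side is the complex linear part of the real derivative \<open>f'\<close>,
  and the Wirtinger derivatives are its coefficients. Evaluating at a whole vector \<open>y\<close>
  keeps real coordinates out of the chain rules below.\<close>

lemma sum_mult_wirt:
  assumes "(f has_derivative f') (at z)"
  shows "(\<Sum>m\<in>UNIV. y $ m * wirt m f z) = (f' y - \<i> * f' (\<i> *s y)) / 2"
proof -
  have lin: "linear f'" using assms has_derivative_linear by blast
  have fd: "frechet_derivative f (at z) = f'" using assms frechet_derivative_at by metis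
  have "f' y - \<i> * f' (\<i> *s y) = (\<Sum>m\<in>UNIV. y $ m * (f' (axis m 1) - \<i> * f' (axis m \<i>)))"
    unfolding linear_eq_sum_axis[OF lin, of y]
      linear_eq_sum_axis[OF lin, of "\<i> *s y"] sum_distrib_left sum_subtractf[symmetric]
    by (rule sum.cong) (simp_all add: scaleR_conv_of_real complex_eq_iff algebra_simps)
  then show ?thesis
    by (simp add: wirt_def fd sum_divide_distrib)
qed

text \<open>Here the right-hand side is the conjugate linear part of \<open>f'\<close>, whence the
  factors \<open>cnj (y $ m)\<close>.\<close>

lemma sum_mult_wirt_bar:
  assumes "(f has_derivative f') (at z)"
  shows "(\<Sum>m\<in>UNIV. cnj (y $ m) * wirt_bar m f z) = (f' y + \<i> * f' (\<i> *s y)) / 2"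
proof -
  have lin: "linear f'" using assms has_derivative_linear by blast
  have fd: "frechet_derivative f (at z) = f'" using assms frechet_derivative_at by metis
  have "f' y + \<i> * f' (\<i> *s y) = (\<Sum>m\<in>UNIV. cnj (y $ m) * (f' (axis m 1) + \<i> * f' (axis m \<i>)))"
    unfolding linear_eq_sum_axis[OF lin, of y]
      linear_eq_sum_axis[OF lin, of "\<i> *s y"] sum_distrib_left sum.distrib[symmetric]
    by (rule sum.cong) (simp_all add: scaleR_conv_of_real complex_eq_iff algebra_simps)
  then show ?thesis
    by (simp add: wirt_bar_def fd sum_divide_distrib)
qed

lemma smult_axis: "\<i> *s axis m 1 = (axis m \<i> :: complex^'n::finite)"
  by (auto simp: vec_eq_iff axis_def)

lemma wirt_eq:
  assumes "(f has_derivative f') (at z)"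
  shows "wirt m f z = (f' (axis m 1) - \<i> * f' (\<i> *s axis m 1)) / 2"
  using frechet_derivative_at[OF assms] by (simp add: wirt_def smult_axis)

lemma wirt_bar_eq:
  assumes "(f has_derivative f') (at z)"
  shows "wirt_bar m f z = (f' (axis m 1) + \<i> * f' (\<i> *s axis m 1)) / 2"
  using frechet_derivative_at[OF assms] by (simp add: wirt_bar_def smult_axis)

text \<open>For a merely real differentiable \<open>g\<close> the general chain rule has a second
  term, containing derivatives of the conjugate of \<open>b\<close>. A complex linear
  \<open>b'\<close> respects the splitting into linear and conjugate linear parts, so that term is
  absent.\<close>

lemma wirt_compose_holo:
  assumes g: "g differentiable at (b z)" and b: "(b has_derivative b') (at z)"
    and lin: "\<And>a v. b' (a *s v) = a *s b' v"
  shows "wirt k (\<lambda>x. g (b x)) z = (\<Sum>m\<in>UNIV. b' (axis k 1) $ m * wirt m g (b z))"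
proof -
  have g': "(g has_derivative frechet_derivative g (at (b z))) (at (b z))"
    using g frechet_derivative_works by blast
  show ?thesis
    unfolding sum_mult_wirt[OF g'] using wirt_eq[OF has_derivative_compose[OF b g']] lin by simp
qed

lemma wirt_bar_compose_holo:
  assumes g: "g differentiable at (b z)" and b: "(b has_derivative b') (at z)"
    and lin: "\<And>a v. b' (a *s v) = a *s b' v"
  shows "wirt_bar k (\<lambda>x. g (b x)) z = (\<Sum>m\<in>UNIV. cnj (b' (axis k 1) $ m) * wirt_bar m g (b z))"
proof -
  have g': "(g has_derivative frechet_derivative g (at (b z))) (at (b z))"
    using g frechet_derivative_works by blast
  show ?thesis
    unfolding sum_mult_wirt_bar[OF g'] using wirt_bar_eq[OF has_derivative_compose[OF b g']] lin by simp
qed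

text \<open>Differentiability is not assumed: both functions have the same derivatives at
  \<open>z\<close>, so both sides choose by the same predicate.\<close>

lemma frechet_derivative_cong_open:
  assumes "open S" "z \<in> S" "\<And>x. x \<in> S \<Longrightarrow> f x = g x"
  shows "frechet_derivative f (at z) = frechet_derivative g (at z)"
  using has_derivative_transform_within_open[OF _ assms(1,2)] assms(3)
  unfolding frechet_derivative_def by (metis (no_types, lifting))

lemma differentiable_cong_open:
  assumes "open S" "z \<in> S" "\<And>x. x \<in> S \<Longrightarrow> f x = g x" "f differentiable at z"
  shows "g differentiable at z"
  using has_derivative_transform_within_open[OF _ assms(1,2)] assms(3,4)
  unfolding differentiable_def by metis

lemma wirt_cong_open:
  assumes "open S" "z \<in> S" "\<And>x. x \<in> S \<Longrightarrow> f x = g x"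
  shows "wirt k f z = wirt k g z" "wirt_bar k f z = wirt_bar k g z"
  using frechet_derivative_cong_open[OF assms] by (simp_all add: wirt_def wirt_bar_def)

lemma wirt_sum_cmult:
  assumes "\<And>i. i \<in> I \<Longrightarrow> f i differentiable at z"
  shows "wirt k (\<lambda>x. \<Sum>i\<in>I. c i * f i x) z = (\<Sum>i\<in>I. c i * wirt k (f i) z)"
    and "wirt_bar k (\<lambda>x. \<Sum>i\<in>I. c i * f i x) z = (\<Sum>i\<in>I. c i * wirt_bar k (f i) z)"
proof -
  have "((\<lambda>x. \<Sum>i\<in>I. c i * f i x) has_derivative
      (\<lambda>v. \<Sum>i\<in>I. c i * frechet_derivative (f i) (at z) v)) (at z)"
    using assms unfolding frechet_derivative_works
    by (intro has_derivative_sum has_derivative_mult_right) auto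
  from wirt_eq[OF this] wirt_bar_eq[OF this]
  show "wirt k (\<lambda>x. \<Sum>i\<in>I. c i * f i x) z = (\<Sum>i\<in>I. c i * wirt k (f i) z)"
    and "wirt_bar k (\<lambda>x. \<Sum>i\<in>I. c i * f i x) z = (\<Sum>i\<in>I. c i * wirt_bar k (f i) z)"
    by (simp_all add: wirt_def wirt_bar_def smult_axis sum_distrib_left algebra_simps
        sum_subtractf sum.distrib sum_divide_distrib diff_divide_distrib add_divide_distrib)
qed

lemma wirt_bar_cnj:
  assumes "f differentiable at z"
  shows "wirt_bar k (\<lambda>x. cnj (f x)) z = cnj (wirt k f z)"
proof -
  have "((\<lambda>x. cnj (f x)) has_derivative (\<lambda>v. cnj (frechet_derivative f (at z) v))) (at z)"
    using assms unfolding frechet_derivative_works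
    by (rule bounded_linear.has_derivative[OF bounded_linear_cnj])
  from wirt_bar_eq[OF this] show ?thesis by (simp add: wirt_def smult_axis)
qed

text \<open>The conjugate of a holomorphic function is antiholomorphic, so \<open>wirt k\<close>
  treats it as a constant factor.\<close>

lemma wirt_mult_cnj_holo:
  assumes f: "f differentiable at z" and d: "(d has_derivative d') (at z)"
    and lin: "\<And>v. d' (\<i> *s v) = \<i> * d' v"
  shows "wirt k (\<lambda>x. cnj (d x) * f x) z = cnj (d z) * wirt k f z"
proof -
  have f': "(f has_derivative frechet_derivative f (at z)) (at z)"
    using f frechet_derivative_works by blast
  have "((\<lambda>x. cnj (d x) * f x) has_derivative
      (\<lambda>v. cnj (d z) * frechet_derivative f (at z) v + cnj (d' v) * f z)) (at z)"
    using f' d by (intro has_derivative_mult bounded_linear.has_derivative[OF bounded_linear_cnj])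
  from wirt_eq[OF this] show ?thesis
    unfolding wirt_eq[OF f'] lin by (simp add: algebra_simps)
qed

lemma wirt_sum:
  assumes "\<And>i. i \<in> I \<Longrightarrow> f i differentiable at z"
  shows "wirt k (\<lambda>x. \<Sum>i\<in>I. f i x) z = (\<Sum>i\<in>I. wirt k (f i) z)"
  using wirt_sum_cmult(1)[of I f z k "\<lambda>_. 1"] assms by simp

section \<open>Smooth functions\<close>

lemma C_k_on_cong:
  assumes "open S" "\<And>x. x \<in> S \<Longrightarrow> f x = g x" "C_k_on k S f"
  shows "C_k_on k S g"
  using assms(2,3)
proof (induction k arbitrary: f g)
  case 0
  then show ?case using continuous_on_cong by fastforce
next
  case (Suc k)
  have "C_k_on k S (\<lambda>x. frechet_derivative g (at x) v)" for v
    using Suc.IH[of "\<lambda>x. frechet_derivative f (at x) v" "\<lambda>x. frechet_derivative g (at x) v"]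
      frechet_derivative_cong_open[OF assms(1) _ Suc.prems(1)] Suc.prems(2) by simp
  then show ?case
    using Suc.prems differentiable_cong_open[OF assms(1) _ Suc.prems(1)] by simp
qed

lemma C_k_on_Suc_imp: "C_k_on (Suc k) S f \<Longrightarrow> C_k_on k S f"
proof (induction k arbitrary: f)
  case 0
  then show ?case
    by (auto intro!: continuous_at_imp_continuous_on differentiable_imp_continuous_within)
next
  case (Suc k)
  then show ?case by (metis C_k_on.simps(2))
qed

text \<open>Any explicit formula \<open>f'\<close> for the derivative may replace the chosen
  \<open>frechet_derivative\<close>. The closure properties below then follow by induction from the
  usual differentiation rules.\<close>

lemma C_k_on_SucI:
  assumes "open S" "\<And>x. x \<in> S \<Longrightarrow> (f has_derivative f' x) (at x)" "\<And>v. C_k_on k S (\<lambda>x. f' x v)"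
  shows "C_k_on (Suc k) S f"
proof -
  have fd: "frechet_derivative f (at x) = f' x" if "x \<in> S" for x
    using assms(2)[OF that] frechet_derivative_at by metis
  have "C_k_on k S (\<lambda>x. frechet_derivative f (at x) v)" for v
    by (rule C_k_on_cong[OF assms(1) _ assms(3)[of v]]) (simp add: fd)
  then show ?thesis using assms(2) by (auto simp: differentiable_def)
qed

lemma C_k_on_SucD:
  assumes "C_k_on (Suc k) S f" "x \<in> S"
  shows "(f has_derivative frechet_derivative f (at x)) (at x)"
  using assms frechet_derivative_works by auto

lemma C_k_on_bounded_linear:
  assumes "open S" "bounded_linear L" "C_k_on k S f"
  shows "C_k_on k S (\<lambda>x. L (f x))"
  using assms(3)
proof (induction k arbitrary: f)
  case 0
  then show ?case using assms(2) by (simp add: bounded_linear.continuous_on)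
next
  case (Suc k)
  show ?case
    by (rule C_k_on_SucI[OF assms(1) bounded_linear.has_derivative[OF assms(2) C_k_on_SucD[OF Suc.prems]]])
      (use Suc in auto)
qed

lemma C_k_on_add:
  assumes "open S" "C_k_on k S f" "C_k_on k S g"
  shows "C_k_on k S (\<lambda>x. f x + g x)"
  using assms(2,3)
proof (induction k arbitrary: f g)
  case 0
  then show ?case by (simp add: continuous_on_add)
next
  case (Suc k)
  show ?case
    by (rule C_k_on_SucI[OF assms(1) has_derivative_add[OF C_k_on_SucD[OF Suc.prems(1)] C_k_on_SucD[OF Suc.prems(2)]]])
      (use Suc in auto)
qed

lemma C_k_on_mult:
  fixes f g :: "'a::real_normed_vector \<Rightarrow> 'b::real_normed_algebra"
  assumes "open S" "C_k_on k S f" "C_k_on k S g"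
  shows "C_k_on k S (\<lambda>x. f x * g x)"
  using assms(2,3)
proof (induction k arbitrary: f g)
  case 0
  then show ?case by (simp add: continuous_on_mult)
next
  case (Suc k)
  \<comment> \<open>The product rule leaves \<open>f\<close> and \<open>g\<close> themselves as
    factors, so their lower regularity is needed next to that of their derivatives.\<close>
  have fg: "C_k_on k S f" "C_k_on k S g" using Suc.prems C_k_on_Suc_imp by auto
  show ?case
    by (rule C_k_on_SucI[OF assms(1) has_derivative_mult[OF C_k_on_SucD[OF Suc.prems(1)] C_k_on_SucD[OF Suc.prems(2)]]])
      (use Suc fg assms(1) in \<open>auto intro!: C_k_on_add\<close>)
qed

text \<open>The derivative of \<open>j\<close> is the same \<open>L\<close> everywhere, so
  differentiating \<open>f (j x)\<close> in direction \<open>v\<close> gives the derivative of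
  \<open>f\<close> in the fixed direction \<open>L v\<close>, again composed with \<open>j\<close>.
  The induction thus needs no product rule. It is applied to the embeddings of slices.\<close>

lemma C_k_on_compose_affine:
  assumes "open S" "open T" "\<And>x. x \<in> T \<Longrightarrow> j x \<in> S" "bounded_linear L"
    "\<And>x. (j has_derivative L) (at x)" "C_k_on k S f"
  shows "C_k_on k T (\<lambda>x. f (j x))"
  using assms(6)
proof (induction k arbitrary: f)
  case 0
  have "continuous_on T j"
    using assms(5) by (meson continuous_at_imp_continuous_on has_derivative_continuous)
  then show ?case using 0 assms(3) by (auto intro: continuous_on_compose2)
next
  case (Suc k)
  show ?case
    by (rule C_k_on_SucI[OF assms(2) has_derivative_compose[OF assms(5) C_k_on_SucD[OF Suc.prems]]])
      (use Suc assms(3) in auto)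
qed

lemma smooth_on_cong:
  "open S \<Longrightarrow> (\<And>x. x \<in> S \<Longrightarrow> f x = g x) \<Longrightarrow> smooth_on S f \<Longrightarrow> smooth_on S g"
  unfolding smooth_on_def using C_k_on_cong by blast

lemma smooth_on_differentiable: "smooth_on S f \<Longrightarrow> x \<in> S \<Longrightarrow> f differentiable at x"
  unfolding smooth_on_def by (metis C_k_on.simps(2))

lemma smooth_on_frechet_derivative:
  "smooth_on S f \<Longrightarrow> smooth_on S (\<lambda>x. frechet_derivative f (at x) v)"
  unfolding smooth_on_def by (metis C_k_on.simps(2))

lemma smooth_on_bounded_linear:
  "open S \<Longrightarrow> bounded_linear L \<Longrightarrow> smooth_on S f \<Longrightarrow> smooth_on S (\<lambda>x. L (f x))"
  unfolding smooth_on_def using C_k_on_bounded_linear by blast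

lemma smooth_on_add:
  "open S \<Longrightarrow> smooth_on S f \<Longrightarrow> smooth_on S g \<Longrightarrow> smooth_on S (\<lambda>x. f x + g x)"
  unfolding smooth_on_def using C_k_on_add by blast

lemma smooth_on_mult:
  fixes f g :: "'a::real_normed_vector \<Rightarrow> 'b::real_normed_algebra"
  shows "open S \<Longrightarrow> smooth_on S f \<Longrightarrow> smooth_on S g \<Longrightarrow> smooth_on S (\<lambda>x. f x * g x)"
  unfolding smooth_on_def using C_k_on_mult by blast

section \<open>Slices and partial derivatives of functions of two variables\<close>

lemma smooth_on_slice_fst:
  assumes "open U" "open V" "smooth_on (U \<times> V) (\<lambda>(z, w). f z w)" "w \<in> V"
  shows "smooth_on U (\<lambda>z. f z w)"
proof -
  have "C_k_on k U (\<lambda>z. (\<lambda>(z, w). f z w) (z, w))" for k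
    by (rule C_k_on_compose_affine[where S="U \<times> V" and L="\<lambda>z. (z, 0)"])
      (use assms in \<open>auto simp: smooth_on_def open_Times bounded_linear_intros
        intro!: derivative_eq_intros bounded_linear_Pair\<close>)
  then show ?thesis by (simp add: smooth_on_def)
qed

lemma has_derivative_slice_snd:
  assumes "(f has_derivative f') (at (z, w))"
  shows "((\<lambda>w. f (z, w)) has_derivative (\<lambda>v. f' (0, v))) (at w)"
  by (rule has_derivative_compose[of "Pair z" "Pair 0"]) (use assms in \<open>auto intro!: derivative_eq_intros\<close>)

lemma smooth_on_slice_snd:
  assumes "open U" "open V" "smooth_on (U \<times> V) (\<lambda>(z, w). f z w)" "z \<in> U"
  shows "smooth_on V (f z)"
proof -
  have "C_k_on k V (\<lambda>w. (\<lambda>(z, w). f z w) (z, w))" for k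
    by (rule C_k_on_compose_affine[where S="U \<times> V" and L="\<lambda>w. (0, w)"])
      (use assms in \<open>auto simp: smooth_on_def open_Times bounded_linear_intros
        intro!: derivative_eq_intros bounded_linear_Pair\<close>)
  then show ?thesis by (simp add: smooth_on_def)
qed

lemma smooth_on_wirt:
  assumes "open S" "smooth_on S f"
  shows "smooth_on S (wirt k f)" "smooth_on S (wirt_bar k f)"
proof -
  have *: "smooth_on S (\<lambda>x. c * frechet_derivative f (at x) v)" for c v
    using smooth_on_bounded_linear[OF assms(1) bounded_linear_mult_right
        smooth_on_frechet_derivative[OF assms(2)]] .
  have e: "wirt k f = (\<lambda>x. 1/2 * frechet_derivative f (at x) (axis k 1) + (-\<i>/2) * frechet_derivative f (at x) (axis k \<i>))"
    "wirt_bar k f = (\<lambda>x. 1/2 * frechet_derivative f (at x) (axis k 1) + (\<i>/2) * frechet_derivative f (at x) (axis k \<i>))"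
    by (auto simp: wirt_def wirt_bar_def field_simps)
  show "smooth_on S (wirt k f)" "smooth_on S (wirt_bar k f)"
    unfolding e by (intro smooth_on_add[OF assms(1)] *)+
qed

text \<open>A derivative in \<open>w\<close> with \<open>z\<close> as parameter is a derivative of
  the joint function in a direction \<open>(0, v)\<close>, hence it stays jointly smooth in both
  variables.\<close>

lemma smooth_on_partial_wirt:
  assumes U: "open U" and V: "open V" and s: "smooth_on (U \<times> V) (\<lambda>(z, w). f z w)"
  shows "smooth_on (U \<times> V) (\<lambda>(z, w). wirt k (f z) w)"
    "smooth_on (U \<times> V) (\<lambda>(z, w). wirt_bar k (f z) w)"
proof -
  let ?f = "\<lambda>(z, w). f z w"
  have S: "open (U \<times> V)" using U V by (rule open_Times)
  have *: "smooth_on (U \<times> V) (\<lambda>x. c * frechet_derivative ?f (at x) v)" for c v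
    using smooth_on_bounded_linear[OF S bounded_linear_mult_right smooth_on_frechet_derivative[OF s]] .
  have fd: "frechet_derivative (f z) (at w) v = frechet_derivative ?f (at (z, w)) (0, v)"
    if "z \<in> U" "w \<in> V" for z w v
  proof -
    have "(?f has_derivative frechet_derivative ?f (at (z, w))) (at (z, w))"
      using smooth_on_differentiable[OF s] that unfolding frechet_derivative_works by blast
    from frechet_derivative_at[OF has_derivative_slice_snd[OF this]] show ?thesis
      by (metis (no_types, lifting) case_prod_conv ext)
  qed
  show "smooth_on (U \<times> V) (\<lambda>(z, w). wirt k (f z) w)"
    by (rule smooth_on_cong[OF S _ smooth_on_add[OF S *[of "1/2" "(0, axis k 1)"] *[of "-\<i>/2" "(0, axis k \<i>)"]]])
      (auto simp: wirt_def fd field_simps)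
  show "smooth_on (U \<times> V) (\<lambda>(z, w). wirt_bar k (f z) w)"
    by (rule smooth_on_cong[OF S _ smooth_on_add[OF S *[of "1/2" "(0, axis k 1)"] *[of "\<i>/2" "(0, axis k \<i>)"]]])
      (auto simp: wirt_bar_def fd field_simps)
qed

section \<open>Holomorphic maps in several variables\<close>

lemma continuous_on_smult:
  "continuous_on S f \<Longrightarrow> continuous_on S (\<lambda>x. f x *s (v :: complex^'n::finite))"
  by (auto intro!: continuous_intros simp: vector_scalar_mult_def continuous_on_vec_lambda)

lemma bounded_linear_smult: "bounded_linear (\<lambda>a. a *s (v :: complex^'n::finite))"
  by (simp add: vec_eq_iff linear_conv_bounded_linear[symmetric])
     (intro linearI, simp_all add: vec_eq_iff algebra_simps)

lemma norm_smult: "norm (a *s (v :: complex^'n::finite)) = cmod a * norm v"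
  by (simp add: norm_vec_def L2_set_left_distrib norm_mult L2_set_def power_mult_distrib
      sum_distrib_left[symmetric] real_sqrt_mult)

lemma has_field_derivative_complex_line:
  fixes f :: "complex^'m::finite \<Rightarrow> complex"
  assumes "(f has_derivative f') (at (x + a *s v))" "\<And>a v. f' (a *s v) = a * f' v"
  shows "((\<lambda>a. f (x + a *s v)) has_field_derivative f' v) (at a)"
proof -
  have "((\<lambda>a. x + a *s v) has_derivative (\<lambda>a. a *s v)) (at a)"
    by (auto intro!: derivative_eq_intros bounded_linear.has_derivative[OF bounded_linear_smult])
  from has_derivative_compose[OF this assms(1)] show ?thesis
    by (simp add: has_field_derivative_def assms(2) mult.commute[of _ "f' v"] fun_eq_iff)
qed

text \<open>Cauchy's formula on the disc of radius \<open>r\<close> in the complex line \<open>x + \<complex> v\<close>; the constant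
  \<open>2 \<pi> \<i>\<close> cancels against the derivative of the circle.\<close>

lemma holo_derivative_integral:
  fixes f :: "complex^'m::finite \<Rightarrow> complex"
  assumes r: "0 < r"
    and f: "\<And>a. cmod a \<le> r \<Longrightarrow> (f has_derivative f' a) (at (x + a *s v))"
    and lin: "\<And>a b y. cmod a \<le> r \<Longrightarrow> f' a (b *s y) = b * f' a y"
  shows "f' 0 v = integral {0..1} (\<lambda>t. inverse (circlepath 0 r t) * f (x + circlepath 0 r t *s v))"
proof -
  let ?h = "\<lambda>a. f (x + a *s v)"
  have h: "(?h has_field_derivative f' a v) (at a)" if "cmod a \<le> r" for a
    using has_field_derivative_complex_line[OF f[OF that] lin[OF that]] .
  have cont: "continuous_on (cball 0 r) ?h"
    using h by (intro continuous_at_imp_continuous_on ballI DERIV_isCont[OF h]) simp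
  have hol: "?h holomorphic_on ball 0 r"
    unfolding holomorphic_on_open[OF open_ball] using h by (metis less_imp_le dist_0_norm mem_ball)
  have "(?h has_field_derivative (1 / (2 * of_real pi * \<i>) *
      contour_integral (circlepath 0 r) (\<lambda>u. ?h u / (u - 0)^2))) (at 0)"
    by (rule Cauchy_derivative_integral_circlepath[OF cont hol]) (use r in auto)
  then have "f' 0 v = 1 / (2 * of_real pi * \<i>) * contour_integral (circlepath 0 r) (\<lambda>u. ?h u / (u - 0)^2)"
    using h[of 0] r DERIV_unique by auto
  also have "contour_integral (circlepath 0 r) (\<lambda>u. ?h u / (u - 0)^2)
      = integral {0..1} (\<lambda>t. ?h (circlepath 0 r t) / (circlepath 0 r t)^2
          * vector_derivative (circlepath 0 r) (at t))"
    by (simp add: contour_integral_integral)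
  also have "\<dots> = integral {0..1} (\<lambda>t. (2 * of_real pi * \<i>) * (inverse (circlepath 0 r t) * ?h (circlepath 0 r t)))"
    unfolding vector_derivative_circlepath unfolding circlepath
    by (rule integral_cong) (use r in \<open>simp add: power2_eq_square field_simps\<close>)
  also have "\<dots> = (2 * of_real pi * \<i>) * integral {0..1} (\<lambda>t. inverse (circlepath 0 r t) * ?h (circlepath 0 r t))"
    by simp
  finally show ?thesis by simp
qed

text \<open>Holomorphy was defined by differentiability alone, so regularity of the derivative has
  to come from Cauchy's formula. It writes \<open>f' x v\<close> as an integral of values of
  \<open>f\<close> with \<open>x\<close> as parameter: this is continuous in \<open>x\<close>, and
  then the Leibniz rule differentiates it under the integral.\<close>

lemma holo_partial_derivative:
  fixes f :: "complex^'m::finite \<Rightarrow> complex"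
  assumes S: "open S"
    and f: "\<And>x. x \<in> S \<Longrightarrow> (f has_derivative f' x) (at x)"
    and lin: "\<And>x a v. x \<in> S \<Longrightarrow> f' x (a *s v) = a * f' x v"
  shows "continuous_on S (\<lambda>x. f' x v)"
    and "x0 \<in> S \<Longrightarrow> \<exists>E. ((\<lambda>x. f' x v) has_derivative E) (at x0) \<and> (\<forall>a y. E (a *s y) = a * E y)"
proof -
  \<comment> \<open>One radius \<open>r\<close> has to serve all \<open>x\<close> near
    \<open>x0\<close>, so that the circle of integration stays fixed while \<open>x\<close>
    varies.\<close>
  have loc: "\<exists>d>0. \<exists>r>0. ball x0 d \<subseteq> S \<and> (\<forall>x\<in>ball x0 d. \<forall>a. cmod a \<le> r \<longrightarrow> x + a *s v \<in> S)"
    if x0: "x0 \<in> S" for x0 v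
  proof -
    obtain e where e: "0 < e" "ball x0 e \<subseteq> S" using S x0 openE by blast
    \<comment> \<open>The summand 1 covers \<open>v = 0\<close>; the choice gives
      \<open>norm (a *s v) \<le> e / 2\<close>, the other half of \<open>e\<close> being used up by
      \<open>x\<close>.\<close>
    define r where "r = e / (2 * (norm v + 1))"
    have "x + a *s v \<in> S" if "x \<in> ball x0 (e/2)" "cmod a \<le> r" for x a
    proof -
      have "norm (a *s v) \<le> r * norm v" by (simp add: norm_smult mult_right_mono that)
      also have "r * norm v = e / 2 * (norm v / (norm v + 1))"
        unfolding r_def by (simp add: mult.commute)
      also have "\<dots> \<le> e / 2 * 1"
        using e(1) norm_ge_zero[of v]
        by (intro mult_left_mono) (simp_all add: pos_divide_le_eq add_nonneg_pos del: norm_ge_zero)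
      finally have "norm (a *s v) \<le> e/2" by simp
      moreover have "dist x0 (x + a *s v) \<le> dist x0 x + norm (a *s v)"
        by (metis dist_triangle dist_add_cancel add.right_neutral dist_0_norm)
      ultimately show ?thesis using that(1) e(2) by auto
    qed
    moreover have "0 < r" using e(1) by (simp add: r_def add_nonneg_pos)
    ultimately show ?thesis
      using e by (intro exI[of _ "e/2"] conjI exI[of _ r]) auto
  qed
  have rep: "f' x v = integral (cbox 0 1) (\<lambda>t. inverse (circlepath 0 r t) * f (x + circlepath 0 r t *s v))"
    if "0 < r" "\<And>a. cmod a \<le> r \<Longrightarrow> x + a *s v \<in> S" for x r v
  proof -
    have "f' (x + 0 *s v) v = integral {0..1} (\<lambda>t. inverse (circlepath 0 r t) * f (x + circlepath 0 r t *s v))"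
      by (rule holo_derivative_integral[OF that(1), of f "\<lambda>a. f' (x + a *s v)"]) (blast intro: f lin that(2))+
    then show ?thesis by simp
  qed
  have cp: "cmod (circlepath 0 r t) = r" "circlepath 0 r t \<noteq> 0" if "0 < r" for r t
    using that by (auto simp: circlepath norm_mult)
  have cpc: "continuous_on T (\<lambda>p. circlepath 0 r (snd p))" for T :: "((complex^'m) \<times> real) set" and r
    unfolding circlepath by (intro continuous_intros)
  \<comment> \<open>Stated for a general \<open>g\<close>, because it is applied to \<open>f\<close>
    and afterwards to the derivatives of \<open>f\<close>.\<close>
  have contc: "continuous_on T (\<lambda>(x, t). inverse (circlepath 0 r t) * g (x + circlepath 0 r t *s v))"
    if "0 < r" "continuous_on S g" "\<And>x t. (x, t) \<in> T \<Longrightarrow> x + circlepath 0 r t *s v \<in> S"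
    for T :: "((complex^'m) \<times> real) set" and r g and v
    unfolding case_prod_unfold
    by (intro continuous_on_mult continuous_on_inverse cpc continuous_on_compose2[OF that(2)]
        continuous_on_add continuous_on_fst continuous_on_id continuous_on_smult)
      (use that cp in auto)
  have contf: "continuous_on S f"
    using f by (meson continuous_at_imp_continuous_on has_derivative_continuous)
  \<comment> \<open>Every direction \<open>v\<close> is covered here, since the Leibniz rule below
    uses continuity of the derivative in all directions.\<close>
  show cont: "continuous_on S (\<lambda>x. f' x v)" for v
  proof (rule continuous_at_imp_continuous_on, rule)
    fix x0 assume "x0 \<in> S"
    from loc[OF this] obtain d r where d: "0 < d" "0 < r"
      and dr: "\<And>x a. x \<in> ball x0 d \<Longrightarrow> cmod a \<le> r \<Longrightarrow> x + a *s v \<in> S" by metis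
    have "continuous_on (ball x0 d) (\<lambda>x. integral (cbox 0 1) (\<lambda>t. inverse (circlepath 0 r t) * f (x + circlepath 0 r t *s v)))"
      by (rule integral_continuous_on_param, rule contc[OF d(2) contf]) (use dr cp[OF d(2)] in auto)
    then have "continuous_on (ball x0 d) (\<lambda>x. f' x v)"
      by (rule continuous_on_eq) (rule rep[OF d(2) dr, symmetric])
    then show "isCont (\<lambda>x. f' x v) x0"
      using d(1) by (simp add: continuous_on_eq_continuous_at)
  qed
  assume "x0 \<in> S"
  from loc[OF this] obtain d r where d: "0 < d" "0 < r"
    and dr: "\<And>x a. x \<in> ball x0 d \<Longrightarrow> cmod a \<le> r \<Longrightarrow> x + a *s v \<in> S" by metis
  let ?c = "\<lambda>t. circlepath 0 r t"
  \<comment> \<open>The Leibniz rule wants the derivative of the integrand as a continuous family of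
    bounded linear maps. In finite dimension this continuity can be checked on one vector at a
    time.\<close>
  define fx where "fx = (\<lambda>x t. Blinfun (\<lambda>h. inverse (?c t) * f' (x + ?c t *s v) h))"
  have inS: "x + ?c t *s v \<in> S" if "x \<in> ball x0 d" for x t using dr that cp[OF d(2)] by simp
  have fx: "blinfun_apply (fx x t) = (\<lambda>h. inverse (?c t) * f' (x + ?c t *s v) h)" if "x \<in> ball x0 d" for x t
    unfolding fx_def using has_derivative_bounded_linear[OF f[OF inS[OF that]]]
    by (intro bounded_linear_Blinfun_apply bounded_linear_mult_right[THEN bounded_linear_compose]) 
  let ?F = "\<lambda>x t. inverse (?c t) * f (x + ?c t *s v)"
  have cfx: "continuous_on (ball x0 d \<times> cbox 0 1) (\<lambda>(x, t). fx x t)"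
  proof (rule continuous_on_blinfun_componentwise)
    fix i :: "complex^'m"
    have "continuous_on (ball x0 d \<times> cbox 0 1) (\<lambda>(x, t). inverse (?c t) * f' (x + ?c t *s v) i)"
      by (rule contc[OF d(2) cont]) (use inS in auto)
    then show "continuous_on (ball x0 d \<times> cbox 0 1) (\<lambda>x. blinfun_apply (case x of (x, t) \<Rightarrow> fx x t) i)"
      by (rule continuous_on_eq) (auto simp: fx)
  qed
  have x0: "x0 \<in> ball x0 d" using d by simp
  have "((\<lambda>x. integral (cbox 0 1) (?F x)) has_derivative integral (cbox 0 1) (fx x0)) (at x0 within ball x0 d)"
  proof (rule leibniz_rule[OF _ _ cfx x0 convex_ball])
    fix x t assume x: "x \<in> ball x0 d" and "t \<in> cbox 0 (1::real)"
    have "((\<lambda>x. x + ?c t *s v) has_derivative (\<lambda>h. h)) (at x)"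
      by (auto intro!: derivative_eq_intros)
    from has_derivative_compose[OF this f[OF inS[OF x]]]
    show "((\<lambda>x. ?F x t) has_derivative blinfun_apply (fx x t)) (at x within ball x0 d)"
      unfolding fx[OF x] by (rule has_derivative_at_withinI[OF has_derivative_mult_right])
  next
    fix x assume x: "x \<in> ball x0 d"
    have "continuous_on ({x} \<times> cbox 0 1) (\<lambda>(x, t). ?F x t)"
      by (rule contc[OF d(2) contf]) (use inS x in auto)
    then have "continuous_on (cbox 0 1) (\<lambda>t. (\<lambda>(x, t). ?F x t) (x, t))"
      by (rule continuous_on_compose2) (auto intro!: continuous_intros)
    then show "?F x integrable_on cbox 0 1"
      by (simp add: integrable_continuous_interval)
  qed
  moreover have "at x0 within ball x0 d = at x0" by (rule at_within_open[OF x0 open_ball])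
  ultimately have D: "((\<lambda>x. integral (cbox 0 1) (?F x)) has_derivative integral (cbox 0 1) (fx x0)) (at x0)"
    by (simp only:)
  have D: "((\<lambda>x. f' x v) has_derivative integral (cbox 0 1) (fx x0)) (at x0)"
    by (rule has_derivative_transform_within_open[OF D open_ball x0])
      (rule rep[OF d(2) dr, symmetric])
  have int: "fx x0 integrable_on cbox 0 1"
  proof -
    have "continuous_on (cbox 0 1) (\<lambda>t. (\<lambda>(x, t). fx x t) (x0, t))"
      by (rule continuous_on_compose2[OF cfx]) (use x0 in \<open>auto intro!: continuous_intros\<close>)
    then show ?thesis by (simp add: integrable_continuous_interval)
  qed
  have "blinfun_apply (integral (cbox 0 1) (fx x0)) (a *s y) = a * blinfun_apply (integral (cbox 0 1) (fx x0)) y" for a y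
    unfolding blinfun_apply_integral[OF int] fx[OF x0]
    by (simp only: lin[OF inS[OF x0]] mult.left_commute[of "inverse _" a] integral_mult_right)
  then show "\<exists>E. ((\<lambda>x. f' x v) has_derivative E) (at x0) \<and> (\<forall>a y. E (a *s y) = a * E y)"
    using D by blast
qed

section \<open>Curvature in coordinates\<close>

text \<open>A positive definite matrix has trivial kernel. The form pairs the second index with
  \<open>cnj v\<close>, so it is tested at the conjugate \<open>v\<close> of a kernel vector
  \<open>x\<close>, which makes \<open>H *v x\<close> appear.\<close>

lemma pos_def_matrix_inv:
  assumes "pos_def H"
  shows "matrix_inv H ** H = mat 1"
proof -
  have "x = 0" if "H *v x = 0" for x
  proof (rule ccontr)
    assume "x \<noteq> 0"
    define v where "v = (\<chi> i. cnj (x $ i))"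
    have "v \<noteq> 0" using \<open>x \<noteq> 0\<close> by (auto simp: v_def vec_eq_iff)
    then have "0 < Re (\<Sum>i\<in>UNIV. \<Sum>j\<in>UNIV. H $ i $ j * v $ i * cnj (v $ j))"
      using assms unfolding pos_def_def by blast
    also have "(\<Sum>i\<in>UNIV. \<Sum>j\<in>UNIV. H $ i $ j * v $ i * cnj (v $ j)) = (\<Sum>i\<in>UNIV. v $ i * (H *v x) $ i)"
      by (simp add: matrix_vector_mult_def sum_distrib_left v_def algebra_simps)
    finally show False by (simp add: that)
  qed
  then have "\<exists>B. B ** H = mat 1" unfolding matrix_left_invertible_ker by blast
  then have "invertible H" by (simp add: invertible_left_inverse)
  then show ?thesis unfolding invertible_def matrix_inv_def by (rule someI2_ex) blast
qed

text \<open>Euler's identity for holomorphic degree one: differentiating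
  \<open>g (a *s w) = a * g w\<close> in \<open>a\<close> at 1 gives
  \<open>g' (t *s w) = t * g w\<close>, which is already complex linear in \<open>t\<close>.\<close>

lemma euler_wirt:
  assumes "g differentiable at w" "\<And>a. a \<noteq> 0 \<Longrightarrow> g (a *s w) = a * g w"
  shows "(\<Sum>i\<in>UNIV. w $ i * wirt i g w) = g w"
proof -
  define g' where "g' = frechet_derivative g (at w)"
  have g: "(g has_derivative g') (at (1 *s w))"
    using assms(1) unfolding frechet_derivative_works g'_def by simp
  have "((\<lambda>a. a *s w) has_derivative (\<lambda>t. t *s w)) (at 1)"
    by (intro bounded_linear_imp_has_derivative bounded_linear_smult)
  \<comment> \<open>Homogeneity is known only for \<open>a \<noteq> 0\<close>; the complement of 0
    is an open neighbourhood of 1, which is enough.\<close>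
  from has_derivative_compose[OF this g]
  have "((\<lambda>a. a * g w) has_derivative (\<lambda>t. g' (t *s w))) (at 1)"
    by (rule has_derivative_transform_within_open[of _ _ _ _ "-{0}"]) (use assms(2) in auto)
  moreover have "((\<lambda>a. a * g w) has_derivative (\<lambda>t. t * g w)) (at 1)"
    by (auto intro!: derivative_eq_intros)
  ultimately have "(\<lambda>t. g' (t *s w)) = (\<lambda>t. t * g w)" by (rule has_derivative_unique)
  then have "g' (1 *s w) = 1 * g w" "g' (\<i> *s w) = \<i> * g w" by metis+
  then show ?thesis
    using sum_mult_wirt[of g g' w w] g by (simp add: mult.assoc[symmetric])
qed

text \<open>Now the scaling factor is \<open>a * cnj a\<close>, with derivative
  \<open>t + cnj t\<close> at 1; its conjugate linear part contributes exactly
  \<open>g w\<close>.\<close>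

lemma euler_wirt_bar:
  assumes "g differentiable at w" "\<And>a. a \<noteq> 0 \<Longrightarrow> g (a *s w) = complex_of_real ((cmod a)\<^sup>2) * g w"
  shows "(\<Sum>i\<in>UNIV. cnj (w $ i) * wirt_bar i g w) = g w"
proof -
  define g' where "g' = frechet_derivative g (at w)"
  have g: "(g has_derivative g') (at (1 *s w))"
    using assms(1) unfolding frechet_derivative_works g'_def by simp
  have "((\<lambda>a. a *s w) has_derivative (\<lambda>t. t *s w)) (at 1)"
    by (intro bounded_linear_imp_has_derivative bounded_linear_smult)
  from has_derivative_compose[OF this g]
  have "((\<lambda>a. a * cnj a * g w) has_derivative (\<lambda>t. g' (t *s w))) (at 1)"
    by (rule has_derivative_transform_within_open[of _ _ _ _ "-{0}"])
      (use assms(2) in \<open>auto simp del: of_real_power simp: complex_norm_square\<close>)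
  moreover have "((\<lambda>a. a * cnj a * g w) has_derivative (\<lambda>t. (t + cnj t) * g w)) (at 1)"
    by (auto intro!: derivative_eq_intros bounded_linear.has_derivative[OF bounded_linear_cnj] simp: algebra_simps)
  ultimately have "(\<lambda>t. g' (t *s w)) = (\<lambda>t. (t + cnj t) * g w)" by (rule has_derivative_unique)
  then have "g' (1 *s w) = (1 + cnj 1) * g w" "g' (\<i> *s w) = (\<i> + cnj \<i>) * g w" by metis+
  then show ?thesis
    using sum_mult_wirt_bar[of g g' w w] g by simp
qed

text \<open>Formal reordering of sums. \<open>A\<close> stands for the second and \<open>C\<close>,
  \<open>D\<close> for the first \<open>z\<close>-derivatives of the Hessian, \<open>I\<close> for
  its inverse and \<open>w'\<close> for the conjugate of \<open>w\<close>. The sums over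
  \<open>i\<close> and \<open>j\<close> move inside, next to the Hessian entries, where Euler's
  identities apply.\<close>

lemma contract_curvature:
  fixes A :: "'n::finite \<Rightarrow> 'n \<Rightarrow> 'n \<Rightarrow> 'n \<Rightarrow> complex"
  shows "(\<Sum>i\<in>UNIV. \<Sum>j\<in>UNIV. \<Sum>k\<in>UNIV. \<Sum>l\<in>UNIV.
      (- A i j k l + (\<Sum>q\<in>UNIV. \<Sum>p\<in>UNIV. I q p * C i q k * D p j l)) * (w i * w' j * w k * w' l)) =
    - (\<Sum>k\<in>UNIV. \<Sum>l\<in>UNIV. w k * w' l * (\<Sum>i\<in>UNIV. \<Sum>j\<in>UNIV. w i * w' j * A i j k l)) +
    (\<Sum>q\<in>UNIV. \<Sum>p\<in>UNIV. I q p * (\<Sum>k\<in>UNIV. w k * (\<Sum>i\<in>UNIV. w i * C i q k))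
       * (\<Sum>l\<in>UNIV. w' l * (\<Sum>j\<in>UNIV. w' j * D p j l)))"
proof -
  have 1: "(\<Sum>i\<in>UNIV. \<Sum>j\<in>UNIV. \<Sum>k\<in>UNIV. \<Sum>l\<in>UNIV. A i j k l * (w i * w' j * w k * w' l)) =
     (\<Sum>k\<in>UNIV. \<Sum>l\<in>UNIV. w k * w' l * (\<Sum>i\<in>UNIV. \<Sum>j\<in>UNIV. w i * w' j * A i j k l))"
    unfolding sum_distrib_left sum_distrib_right sum.cartesian_product
    by (rule sum.reindex_bij_witness[where i="\<lambda>(k, l, i, j). (i, j, k, l)" and j="\<lambda>(i, j, k, l). (k, l, i, j)"])
      (auto simp: mult_ac)
  have 2: "(\<Sum>i\<in>UNIV. \<Sum>j\<in>UNIV. \<Sum>k\<in>UNIV. \<Sum>l\<in>UNIV.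
      (\<Sum>q\<in>UNIV. \<Sum>p\<in>UNIV. I q p * C i q k * D p j l) * (w i * w' j * w k * w' l)) =
    (\<Sum>q\<in>UNIV. \<Sum>p\<in>UNIV. \<Sum>l\<in>UNIV. \<Sum>j\<in>UNIV. \<Sum>k\<in>UNIV. \<Sum>i\<in>UNIV.
       I q p * (w k * (w i * C i q k)) * (w' l * (w' j * D p j l)))"
    unfolding sum_distrib_left sum_distrib_right sum.cartesian_product
    by (rule sum.reindex_bij_witness[where i="\<lambda>(q, p, l, j, k, i). (i, j, k, l, q, p)"
          and j="\<lambda>(i, j, k, l, q, p). (q, p, l, j, k, i)"])
      (auto simp: mult_ac)
  have 3: "\<dots> = (\<Sum>q\<in>UNIV. \<Sum>p\<in>UNIV. I q p * (\<Sum>k\<in>UNIV. w k * (\<Sum>i\<in>UNIV. w i * C i q k))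
       * (\<Sum>l\<in>UNIV. w' l * (\<Sum>j\<in>UNIV. w' j * D p j l)))"
    by (simp only: sum_distrib_left sum_distrib_right) 
  show ?thesis
    unfolding 3[symmetric] 2[symmetric] 1[symmetric]
    by (simp only: distrib_right sum.distrib mult_minus_left sum_negf)
qed

lemma holo_on_derivative_component:
  fixes b :: "complex^'m::finite \<Rightarrow> complex^'n::finite"
  assumes "open U" "\<And>z. z \<in> U \<Longrightarrow> (b has_derivative b' z) (at z)"
    "\<And>z a v. z \<in> U \<Longrightarrow> b' z (a *s v) = a *s b' z v" "z \<in> U"
  shows "\<exists>E. ((\<lambda>z. b' z v $ m) has_derivative E) (at z) \<and> (\<forall>a y. E (a *s y) = a * E y)"
proof (rule holo_partial_derivative(2)[of U "\<lambda>z. b z $ m" "\<lambda>z v. b' z v $ m"])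
  show "((\<lambda>z. b z $ m) has_derivative (\<lambda>v. b' x v $ m)) (at x)" if "x \<in> U" for x
    by (rule bounded_linear.has_derivative[OF bounded_linear_vec_nth assms(2)[OF that]])
qed (simp_all only: assms vector_smult_component)

text \<open>The whole computation in one chart. The group enters only through \<open>B\<close>, a
  holomorphic family of complex linear maps that is the identity at \<open>z0\<close> and carries
  \<open>GG z\<close> to \<open>GG z0\<close>.\<close>

lemma hol_sect_curv_coord_eq_0:
  fixes GG :: "complex^'n::finite \<Rightarrow> complex^'n \<Rightarrow> complex" and B :: "complex^'n \<Rightarrow> complex^'n \<Rightarrow> complex^'n"
  assumes U: "open U" and z0: "z0 \<in> U" and w: "w \<noteq> 0"
    and smooth: "smooth_on (U \<times> (- {0})) (\<lambda>(z, w). GG z w)"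
    and real: "\<And>z w. cnj (GG z w) = GG z w"
    and hom: "\<And>z w a. z \<in> U \<Longrightarrow> GG z (a *s w) = complex_of_real ((cmod a)\<^sup>2) * GG z w"
    and pd: "\<And>z w. z \<in> U \<Longrightarrow> w \<noteq> 0 \<Longrightarrow> pos_def (hess GG z w)"
    and B_holo: "\<And>u. holo_on U (\<lambda>z. B z u)"
    and B_lin: "\<And>z. z \<in> U \<Longrightarrow> linear (B z)" "\<And>z a u. z \<in> U \<Longrightarrow> B z (a *s u) = a *s B z u"
    and B_ne: "\<And>z u. z \<in> U \<Longrightarrow> u \<noteq> 0 \<Longrightarrow> B z u \<noteq> 0"
    and B_z0: "\<And>u. B z0 u = u"
    and GG_B: "\<And>z u. z \<in> U \<Longrightarrow> GG z u = GG z0 (B z u)"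
  shows "hol_sect_curv_coord GG z0 w = 0"
proof -
  \<comment> \<open>\<open>N q\<close> is the first derivative of \<open>GG\<close> with conjugated
    index \<open>q\<close>; the Hessian entries are its derivatives in \<open>w\<close>.\<close>
  define N where "N = (\<lambda>q z w. wirt_bar q (GG z) w)"
  define H where "H = (\<lambda>i j z w. hess GG z w $ i $ j)"
  have H: "H i j z w = wirt i (N j z) w" for i j z w by (simp add: H_def N_def hess_def)
  have V: "open (- {0 :: complex^'n})" by (simp add: open_Compl)
  have sN: "smooth_on (U \<times> (- {0})) (\<lambda>(z, w). N q z w)" for q
    unfolding N_def by (rule smooth_on_partial_wirt(2)[OF U V smooth])
  have sH: "smooth_on (U \<times> (- {0})) (\<lambda>(z, w). H i j z w)" for i j
    unfolding H by (rule smooth_on_partial_wirt(1)[OF U V sN])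
  have dG: "GG z differentiable at v" if "z \<in> U" "v \<noteq> 0" for z v
    using smooth_on_differentiable[OF smooth_on_slice_snd[OF U V smooth]] that by simp
  have dN: "N q z differentiable at v" if "z \<in> U" "v \<noteq> 0" for z v q
    using smooth_on_differentiable[OF smooth_on_slice_snd[OF U V sN]] that by simp
  have dNz: "(\<lambda>z. N q z w) differentiable at z" if "z \<in> U" for z q
    using smooth_on_differentiable[OF smooth_on_slice_fst[OF U V sN]] that w by simp
  have sHz: "smooth_on U (\<lambda>z. H i j z w)" for i j
    using smooth_on_slice_fst[OF U V sH] w by simp
  have dHz: "(\<lambda>z. H i j z w) differentiable at z" if "z \<in> U" for z i j
    using smooth_on_differentiable[OF sHz that] .
  have dHz2: "wirt_bar l (\<lambda>z. H i j z w) differentiable at z" if "z \<in> U" for z i j l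
    using smooth_on_differentiable[OF smooth_on_wirt(2)[OF U sHz] that] .

  \<comment> \<open>Homogeneity in \<open>w\<close> and Euler's identities\<close>
  have N_hom: "N q z (a *s v) = a * N q z v" if z: "z \<in> U" and v: "v \<noteq> 0" and a: "a \<noteq> 0" for q z v a
  proof -
    have D: "((\<lambda>x. a *s x) has_derivative (\<lambda>x. a *s x)) (at v)"
    proof (rule bounded_linear_imp_has_derivative)
      show "bounded_linear (\<lambda>x::complex^'n. a *s x)"
        unfolding linear_conv_bounded_linear[symmetric]
        by (rule linearI) (simp_all add: vec_eq_iff algebra_simps)
    qed
    \<comment> \<open>The derivative of \<open>GG z (a *s x)\<close> is computed twice: the chain
      rule produces the factor \<open>cnj a\<close>, homogeneity the factor
      \<open>a * cnj a\<close>. Cancelling \<open>cnj a\<close> leaves \<open>N q z\<close>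
      homogeneous of degree one in \<open>a\<close> alone.\<close>
    have "wirt_bar q (\<lambda>x. GG z (a *s x)) v = (\<Sum>m\<in>UNIV. cnj ((a *s axis q 1) $ m) * wirt_bar m (GG z) (a *s v))"
      by (rule wirt_bar_compose_holo[OF dG[OF z] D]) (use a v in \<open>auto simp: mult.commute vec_eq_iff\<close>)
    also have "\<dots> = (\<Sum>m\<in>UNIV. if m = q then cnj a * N m z (a *s v) else 0)"
      by (rule sum.cong) (auto simp: axis_def N_def)
    finally have "wirt_bar q (\<lambda>x. GG z (a *s x)) v = cnj a * N q z (a *s v)" by simp
    moreover have "wirt_bar q (\<lambda>x. GG z (a *s x)) v = a * cnj a * N q z v"
      unfolding hom[OF z] complex_norm_square N_def
      using wirt_sum_cmult(2)[of "{()}" "\<lambda>_. GG z" v q "\<lambda>_. a * cnj a"] dG[OF z v] by simp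
    ultimately show ?thesis using a by simp
  qed
  have euler_H: "(\<Sum>i\<in>UNIV. w $ i * H i q z w) = N q z w" if "z \<in> U" for q z
    unfolding H using euler_wirt[OF dN[OF that w] N_hom[OF that w]] .
  have herm: "H i j z w = cnj (H j i z w)" if "z \<in> U" for i j z
    using pd[OF that w] unfolding pos_def_def H_def by blast
  have euler_H': "(\<Sum>j\<in>UNIV. cnj (w $ j) * H p j z w) = cnj (N p z w)" if "z \<in> U" for p z
    unfolding euler_H[OF that, symmetric] cnj_sum complex_cnj_mult herm[OF that, symmetric] ..
  have euler_HH: "(\<Sum>i\<in>UNIV. \<Sum>j\<in>UNIV. w $ i * cnj (w $ j) * H i j z w) = GG z w" if z: "z \<in> U" for z
  proof -
    have "(\<Sum>i\<in>UNIV. \<Sum>j\<in>UNIV. w $ i * cnj (w $ j) * H i j z w) =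
        (\<Sum>j\<in>UNIV. cnj (w $ j) * (\<Sum>i\<in>UNIV. w $ i * H i j z w))"
      unfolding sum_distrib_left by (subst sum.swap) (simp add: mult_ac)
    also have "\<dots> = GG z w"
      unfolding euler_H[OF z] N_def using euler_wirt_bar[OF dG[OF z w] hom[OF z]] .
    finally show ?thesis .
  qed

  \<comment> \<open>Derivatives in \<open>z\<close> at \<open>z0\<close>, computed through the
    holomorphic family \<open>B\<close>\<close>
  let ?b = "\<lambda>z. B z w"
  obtain b' where b': "\<And>z. z \<in> U \<Longrightarrow> (?b has_derivative b' z) (at z)"
    and b'_lin: "\<And>z a v. z \<in> U \<Longrightarrow> b' z (a *s v) = a *s b' z v"
    using B_holo[of w] unfolding holo_on_def by metis
  \<comment> \<open>All \<open>z\<close>-derivatives at \<open>z0\<close> will be expressed by the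
    Jacobian \<open>D\<close> of \<open>B z w\<close> in \<open>z\<close> and the Hessian
    \<open>H0\<close>.\<close>
  define D where "D = (\<lambda>k a. b' z0 (axis k 1) $ a)"
  define H0 where "H0 = (\<lambda>i j. H i j z0 w)"
  define M where "M = (\<lambda>q k. wirt k (\<lambda>z. N q z w) z0)"
  have dNb: "(\<lambda>z. N m z0 (?b z)) differentiable at z" if z: "z \<in> U" for z m
  proof -
    have "(N m z0 has_derivative frechet_derivative (N m z0) (at (?b z))) (at (?b z))"
      using dN[OF z0 B_ne[OF z w]] frechet_derivative_works by blast
    from has_derivative_compose[OF b'[OF z] this] show ?thesis unfolding differentiable_def by blast
  qed
  have wNb: "wirt k (\<lambda>z. N m z0 (?b z)) z0 = (\<Sum>a\<in>UNIV. D k a * H0 a m)" for k m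
    unfolding wirt_compose_holo[OF dN[OF z0 B_ne[OF z0 w]] b'[OF z0] b'_lin[OF z0]]
    by (simp add: D_def H0_def H B_z0)
  \<comment> \<open>Conjugated holomorphic factors pass through \<open>wirt k\<close>, so only
    \<open>N m z0 (B z w)\<close> is differentiated. This serves twice: with \<open>d\<close> a
    derivative of \<open>B z w\<close>, and with \<open>d\<close> an entry of
    \<open>B z\<close>.\<close>
  have mult_cnj: "wirt k (\<lambda>z. \<Sum>m\<in>UNIV. cnj (d m z) * N m z0 (?b z)) z0 =
      (\<Sum>m\<in>UNIV. cnj (d m z0) * (\<Sum>a\<in>UNIV. D k a * H0 a m))"
    if d: "\<And>m. \<exists>E. (d m has_derivative E) (at z0) \<and> (\<forall>a y. E (a *s y) = a * E y)" for d k
  proof -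
    have "(\<lambda>z. cnj (d m z) * N m z0 (?b z)) differentiable at z0" for m
    proof -
      obtain E where "(d m has_derivative E) (at z0)" using d by blast
      then have "(\<lambda>z. cnj (d m z)) differentiable at z0"
        unfolding differentiable_def using bounded_linear.has_derivative[OF bounded_linear_cnj] by blast
      then show ?thesis using dNb[OF z0] by (rule differentiable_mult)
    qed
    moreover have "wirt k (\<lambda>z. cnj (d m z) * N m z0 (?b z)) z0 = cnj (d m z0) * (\<Sum>a\<in>UNIV. D k a * H0 a m)" for m
    proof -
      obtain E where E: "(d m has_derivative E) (at z0)" "\<forall>a y. E (a *s y) = a * E y" using d by blast
      show ?thesis
        unfolding wNb[symmetric] by (rule wirt_mult_cnj_holo[OF dNb[OF z0] E(1)]) (use E(2) in blast)
    qed
    ultimately show ?thesis by (subst wirt_sum) auto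
  qed
  \<comment> \<open>The inner derivative produces the conjugated derivatives of \<open>B z w\<close>
    as coefficients. That these derivatives are themselves holomorphic in \<open>z\<close> rests on
    Cauchy's formula.\<close>
  have T: "wirt k (wirt_bar l (\<lambda>z. GG z w)) z0 =
      (\<Sum>m\<in>UNIV. cnj (D l m) * (\<Sum>a\<in>UNIV. D k a * H0 a m))" for k l
  proof -
    have *: "wirt_bar l (\<lambda>z. GG z w) z = (\<Sum>m\<in>UNIV. cnj (b' z (axis l 1) $ m) * N m z0 (?b z))" if z: "z \<in> U" for z
    proof -
      have "wirt_bar l (\<lambda>z. GG z w) z = wirt_bar l (\<lambda>z. GG z0 (?b z)) z"
        by (rule wirt_cong_open(2)[OF U z GG_B])
      also have "\<dots> = (\<Sum>m\<in>UNIV. cnj (b' z (axis l 1) $ m) * N m z0 (?b z))"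
        unfolding N_def by (rule wirt_bar_compose_holo[OF dG[OF z0 B_ne[OF z w]] b'[OF z] b'_lin[OF z]])
      finally show ?thesis .
    qed
    have "wirt k (wirt_bar l (\<lambda>z. GG z w)) z0 =
        wirt k (\<lambda>z. \<Sum>m\<in>UNIV. cnj (b' z (axis l 1) $ m) * N m z0 (?b z)) z0"
      by (rule wirt_cong_open(1)[OF U z0 *])
    also have "\<dots> = (\<Sum>m\<in>UNIV. cnj (b' z0 (axis l 1) $ m) * (\<Sum>a\<in>UNIV. D k a * H0 a m))"
      by (rule mult_cnj) (rule holo_on_derivative_component[OF U b' b'_lin z0])
    finally show ?thesis by (simp only: D_def)
  qed
  have M: "M q k = (\<Sum>a\<in>UNIV. D k a * H0 a q)" for q k
  proof -
    \<comment> \<open>Chain rule in \<open>w\<close> for the linear map \<open>B z\<close>. At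
      \<open>z0\<close> the coefficients become those of the identity, so only \<open>m = q\<close>
      survives there.\<close>
    have *: "N q z w = (\<Sum>m\<in>UNIV. cnj (B z (axis q 1) $ m) * N m z0 (?b z))" if z: "z \<in> U" for z
    proof -
      have B': "(B z has_derivative B z) (at w)"
        using B_lin(1)[OF z] by (intro bounded_linear_imp_has_derivative) (simp add: linear_conv_bounded_linear)
      have "GG z = (\<lambda>u. GG z0 (B z u))" using GG_B[OF z] by auto
      then have "N q z w = wirt_bar q (\<lambda>u. GG z0 (B z u)) w" by (simp add: N_def)
      also have "\<dots> = (\<Sum>m\<in>UNIV. cnj (B z (axis q 1) $ m) * N m z0 (?b z))"
        unfolding N_def by (rule wirt_bar_compose_holo[OF dG[OF z0 B_ne[OF z w]] B' B_lin(2)[OF z]])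
      finally show ?thesis .
    qed
    have "M q k = wirt k (\<lambda>z. \<Sum>m\<in>UNIV. cnj (B z (axis q 1) $ m) * N m z0 (?b z)) z0"
      unfolding M_def by (rule wirt_cong_open(1)[OF U z0 *])
    also have "\<dots> = (\<Sum>m\<in>UNIV. cnj (B z0 (axis q 1) $ m) * (\<Sum>a\<in>UNIV. D k a * H0 a m))"
    proof (rule mult_cnj)
      fix m
      obtain E where "((\<lambda>z. B z (axis q 1)) has_derivative E) (at z0)" "\<forall>a v. E (a *s v) = a *s E v"
        using B_holo[of "axis q 1"] z0 unfolding holo_on_def by blast
      then show "\<exists>E. ((\<lambda>z. B z (axis q 1) $ m) has_derivative E) (at z0) \<and> (\<forall>a y. E (a *s y) = a * E y)"
        by (intro exI[of _ "\<lambda>v. E v $ m"]) (auto intro!: bounded_linear.has_derivative[OF bounded_linear_vec_nth])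
    qed
    also have "\<dots> = (\<Sum>m\<in>UNIV. if m = q then (\<Sum>a\<in>UNIV. D k a * H0 a m) else 0)"
      by (rule sum.cong) (auto simp: B_z0 axis_def)
    finally show ?thesis by simp
  qed

  \<comment> \<open>Contraction of the curvature with \<open>w\<close>, which is constant under the
    \<open>z\<close>-derivatives\<close>
  have A: "(\<Sum>i\<in>UNIV. \<Sum>j\<in>UNIV. w $ i * cnj (w $ j) * wirt k (wirt_bar l (\<lambda>z. H i j z w)) z0)
      = wirt k (wirt_bar l (\<lambda>z. GG z w)) z0" for k l
  proof -
    \<comment> \<open>The double sum is treated as one sum over index pairs, so that linearity of
      the derivatives applies in one go.\<close>
    let ?c = "\<lambda>x. w $ fst x * cnj (w $ snd x)"
    have GG: "GG z w = (\<Sum>x\<in>UNIV. ?c x * H (fst x) (snd x) z w)" if "z \<in> U" for z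
      unfolding euler_HH[OF that, symmetric] sum.cartesian_product by (simp add: case_prod_unfold)
    have *: "wirt_bar l (\<lambda>z. GG z w) z =
        (\<Sum>x\<in>UNIV. ?c x * wirt_bar l (\<lambda>z. H (fst x) (snd x) z w) z)" if z: "z \<in> U" for z
    proof -
      have "wirt_bar l (\<lambda>z. GG z w) z = wirt_bar l (\<lambda>z. \<Sum>x\<in>UNIV. ?c x * H (fst x) (snd x) z w) z"
        by (rule wirt_cong_open(2)[OF U z GG])
      also have "\<dots> = (\<Sum>x\<in>UNIV. ?c x * wirt_bar l (\<lambda>z. H (fst x) (snd x) z w) z)"
        by (rule wirt_sum_cmult(2)) (rule dHz[OF z])
      finally show ?thesis .
    qed
    have "wirt k (wirt_bar l (\<lambda>z. GG z w)) z0 =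
        wirt k (\<lambda>z. \<Sum>x\<in>UNIV. ?c x * wirt_bar l (\<lambda>z. H (fst x) (snd x) z w) z) z0"
      by (rule wirt_cong_open(1)[OF U z0 *])
    also have "\<dots> = (\<Sum>x\<in>UNIV. ?c x * wirt k (wirt_bar l (\<lambda>z. H (fst x) (snd x) z w)) z0)"
      by (rule wirt_sum_cmult(1)) (rule dHz2[OF z0])
    finally show ?thesis
      unfolding sum.cartesian_product by (simp add: case_prod_unfold)
  qed
  have C1: "(\<Sum>i\<in>UNIV. w $ i * wirt k (\<lambda>z. H i q z w) z0) = M q k" for q k
  proof -
    have "M q k = wirt k (\<lambda>z. \<Sum>i\<in>UNIV. w $ i * H i q z w) z0"
      unfolding M_def by (rule wirt_cong_open(1)[OF U z0 euler_H[symmetric]])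
    also have "\<dots> = (\<Sum>i\<in>UNIV. w $ i * wirt k (\<lambda>z. H i q z w) z0)"
      by (rule wirt_sum_cmult(1)) (rule dHz[OF z0])
    finally show ?thesis ..
  qed
  \<comment> \<open>Hermitian symmetry turns this contraction into the conjugate of the previous
    one.\<close>
  have C2: "(\<Sum>j\<in>UNIV. cnj (w $ j) * wirt_bar l (\<lambda>z. H p j z w) z0) = cnj (M p l)" for p l
  proof -
    have "cnj (M p l) = wirt_bar l (\<lambda>z. cnj (N p z w)) z0"
      unfolding M_def by (rule wirt_bar_cnj[OF dNz[OF z0], symmetric])
    also have "\<dots> = wirt_bar l (\<lambda>z. \<Sum>j\<in>UNIV. cnj (w $ j) * H p j z w) z0"
      by (rule wirt_cong_open(2)[OF U z0 euler_H'[symmetric]])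
    also have "\<dots> = (\<Sum>j\<in>UNIV. cnj (w $ j) * wirt_bar l (\<lambda>z. H p j z w) z0)"
      by (rule wirt_sum_cmult(2)) (rule dHz[OF z0])
    finally show ?thesis ..
  qed
  define I where "I = (\<lambda>q p. matrix_inv (hess GG z0 w) $ q $ p)"
  have I: "(\<Sum>p\<in>UNIV. I q p * H0 p b) = (if q = b then 1 else 0)" for q b
    using arg_cong[OF pos_def_matrix_inv[OF pd[OF z0 w]], of "\<lambda>X. X $ q $ b"]
    by (simp add: I_def H0_def H_def matrix_matrix_mult_def mat_def)
  \<comment> \<open>The inverse Hessian cancels one of the two factors \<open>H0\<close> in the
    second curvature term.\<close>
  have inverse_H0: "(\<Sum>p\<in>UNIV. I q p * S * (\<Sum>b\<in>UNIV. H0 p b * c b)) = S * c q" for q S c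
  proof -
    have "(\<Sum>p\<in>UNIV. I q p * S * (\<Sum>b\<in>UNIV. H0 p b * c b)) =
        (\<Sum>b\<in>UNIV. (\<Sum>p\<in>UNIV. I q p * H0 p b) * (S * c b))"
      unfolding sum_distrib_left sum_distrib_right by (subst sum.swap) (simp only: mult_ac)
    also have "\<dots> = (\<Sum>b\<in>UNIV. if q = b then S * c b else 0)"
      unfolding I by (rule sum.cong) auto
    finally show ?thesis by simp
  qed
  have Hh: "hess GG z w $ i $ j = H i j z w" for i j z by (simp add: H_def)
  have Ih: "matrix_inv (hess GG z0 w) $ q $ p = I q p" for q p by (simp add: I_def)
  \<comment> \<open>\<open>W\<close> is the derivative of \<open>B z w\<close> at \<open>z0\<close>
    in the direction \<open>w\<close>.\<close>
  define W where "W = (\<lambda>a. \<Sum>k\<in>UNIV. w $ k * D k a)"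
  have WM: "(\<Sum>k\<in>UNIV. w $ k * M q k) = (\<Sum>a\<in>UNIV. W a * H0 a q)" for q
    unfolding M W_def sum_distrib_left sum_distrib_right by (subst sum.swap) (simp add: mult_ac)
  have herm0: "cnj (H0 a p) = H0 p a" for a p unfolding H0_def by (rule herm[OF z0, symmetric])
  have WM': "(\<Sum>l\<in>UNIV. cnj (w $ l) * cnj (M p l)) = (\<Sum>b\<in>UNIV. H0 p b * cnj (W b))" for p
    using arg_cong[OF WM[of p], of cnj] by (simp add: herm0 mult.commute)
  have WT: "(\<Sum>k\<in>UNIV. \<Sum>l\<in>UNIV. w $ k * cnj (w $ l) * (\<Sum>m\<in>UNIV. cnj (D l m) * (\<Sum>a\<in>UNIV. D k a * H0 a m)))
      = (\<Sum>m\<in>UNIV. (\<Sum>a\<in>UNIV. W a * H0 a m) * cnj (W m))"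
    unfolding W_def sum_distrib_left sum_distrib_right cnj_sum sum.cartesian_product
    by (rule sum.reindex_bij_witness[where i="\<lambda>(m, l, a, k). (k, l, m, a)" and j="\<lambda>(k, l, m, a). (m, l, a, k)"])
      (auto simp: mult_ac)
  have "(\<Sum>i\<in>UNIV. \<Sum>j\<in>UNIV. \<Sum>k\<in>UNIV. \<Sum>l\<in>UNIV.
      curv GG z0 w i j k l * (w $ i * cnj (w $ j) * w $ k * cnj (w $ l))) =
     - (\<Sum>m\<in>UNIV. (\<Sum>a\<in>UNIV. W a * H0 a m) * cnj (W m)) +
     (\<Sum>q\<in>UNIV. \<Sum>p\<in>UNIV. I q p * (\<Sum>a\<in>UNIV. W a * H0 a q) * (\<Sum>b\<in>UNIV. H0 p b * cnj (W b)))"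
    unfolding curv_def Hh Ih contract_curvature A C1 C2 T WM WM' WT ..
  \<comment> \<open>After this cancellation the second term is the Hessian form of \<open>W\<close>,
    equal to the first term up to sign.\<close>
  also have "(\<Sum>q\<in>UNIV. \<Sum>p\<in>UNIV. I q p * (\<Sum>a\<in>UNIV. W a * H0 a q) * (\<Sum>b\<in>UNIV. H0 p b * cnj (W b))) =
     (\<Sum>m\<in>UNIV. (\<Sum>a\<in>UNIV. W a * H0 a m) * cnj (W m))"
    unfolding inverse_H0 ..
  finally have "(\<Sum>i\<in>UNIV. \<Sum>j\<in>UNIV. \<Sum>k\<in>UNIV. \<Sum>l\<in>UNIV.
      curv GG z0 w i j k l * (w $ i * cnj (w $ j) * w $ k * cnj (w $ l))) = 0" by simp
  then show ?thesis
    unfolding hol_sect_curv_coord_def sum_divide_distrib[symmetric] by simp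
qed

section \<open>Pointwise complex differentiability\<close>

text \<open>The pointwise form of \<open>holo_on\<close>. Together with eventual equality near a
  point it spares the bookkeeping of chart domains.\<close>

definition cdiff_at :: "(complex^'m::finite \<Rightarrow> complex^'n::finite) \<Rightarrow> complex^'m \<Rightarrow> bool" where
  "cdiff_at f x \<longleftrightarrow> (\<exists>f'. (f has_derivative f') (at x) \<and> (\<forall>a v. f' (a *s v) = a *s f' v))"

lemma holo_on_iff_cdiff_at: "holo_on S f \<longleftrightarrow> (\<forall>x\<in>S. cdiff_at f x)"
  by (simp add: holo_on_def cdiff_at_def)

lemma cdiff_at_has_derivative:
  "cdiff_at f x \<Longrightarrow> (f has_derivative frechet_derivative f (at x)) (at x)"
  unfolding cdiff_at_def using frechet_derivative_at by metis

lemma cdiff_at_smult: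
  "cdiff_at f x \<Longrightarrow> frechet_derivative f (at x) (a *s v) = a *s frechet_derivative f (at x) v"
  unfolding cdiff_at_def using frechet_derivative_at by metis

lemma cdiff_at_isCont: "cdiff_at f x \<Longrightarrow> isCont f x"
  unfolding cdiff_at_def using has_derivative_continuous by blast

lemma frechet_derivative_chain:
  assumes "cdiff_at f x" "cdiff_at g (f x)"
  shows "frechet_derivative (\<lambda>x. g (f x)) (at x) v = frechet_derivative g (at (f x)) (frechet_derivative f (at x) v)"
  using frechet_derivative_at[OF has_derivative_compose[OF cdiff_at_has_derivative[OF assms(1)]
        cdiff_at_has_derivative[OF assms(2)]]] by metis

lemma cdiff_at_compose:
  assumes "cdiff_at f x" "cdiff_at g (f x)"
  shows "cdiff_at (\<lambda>x. g (f x)) x"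
  unfolding cdiff_at_def
  using has_derivative_compose[OF cdiff_at_has_derivative[OF assms(1)] cdiff_at_has_derivative[OF assms(2)]]
    cdiff_at_smult[OF assms(1)] cdiff_at_smult[OF assms(2)] by metis

lemma has_derivative_cong_eventually:
  assumes "\<forall>\<^sub>F y in nhds x. f y = g y" "(f has_derivative f') (at x)"
  shows "(g has_derivative f') (at x)"
proof -
  obtain S where "open S" "x \<in> S" "\<And>y. y \<in> S \<Longrightarrow> f y = g y"
    using assms(1) unfolding eventually_nhds by blast
  then show ?thesis using has_derivative_transform_within_open[OF assms(2)] by blast
qed

lemma cdiff_at_cong_eventually:
  assumes "\<forall>\<^sub>F y in nhds x. f y = g y" "cdiff_at f x"
  shows "cdiff_at g x"
  using assms has_derivative_cong_eventually unfolding cdiff_at_def by metis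

lemma frechet_derivative_cong_eventually:
  assumes "\<forall>\<^sub>F y in nhds x. f y = g y" "cdiff_at f x"
  shows "frechet_derivative f (at x) = frechet_derivative g (at x)"
  using frechet_derivative_at[OF has_derivative_cong_eventually[OF assms(1) cdiff_at_has_derivative[OF assms(2)]]] .

lemma has_derivative_vecI:
  fixes f :: "'a::real_normed_vector \<Rightarrow> complex^'n::finite"
  assumes "\<And>i. ((\<lambda>x. f x $ i) has_derivative (\<lambda>v. f' v $ i)) F"
  shows "(f has_derivative f') F"
proof -
  have bl: "bounded_linear (axis i :: complex \<Rightarrow> complex^'n)" for i
    unfolding linear_conv_bounded_linear[symmetric]
    by (rule linearI) (auto simp: vec_eq_iff axis_def)
  have e: "y = (\<Sum>i\<in>UNIV. axis i (y $ i))" for y :: "complex^'n"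
    by (simp add: vec_eq_iff axis_def sum_component if_distrib cong: if_cong)
  have "((\<lambda>x. \<Sum>i\<in>UNIV. axis i (f x $ i)) has_derivative (\<lambda>v. \<Sum>i\<in>UNIV. axis i (f' v $ i))) F"
    by (intro has_derivative_sum bounded_linear.has_derivative[OF bl] assms)
  then show ?thesis unfolding e[symmetric] .
qed

lemma cdiff_at_vec_iff:
  "cdiff_at f x \<longleftrightarrow> (\<forall>i. \<exists>E. ((\<lambda>x. f x $ i) has_derivative E) (at x) \<and> (\<forall>a v. E (a *s v) = a * E v))"
  (is "_ \<longleftrightarrow> ?R")
proof
  assume "cdiff_at f x"
  then obtain f' where f': "(f has_derivative f') (at x)" "\<forall>a v. f' (a *s v) = a *s f' v"
    unfolding cdiff_at_def by blast
  show ?R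
  proof
    fix i show "\<exists>E. ((\<lambda>x. f x $ i) has_derivative E) (at x) \<and> (\<forall>a v. E (a *s v) = a * E v)"
      by (rule exI[of _ "\<lambda>v. f' v $ i"])
        (use f' bounded_linear.has_derivative[OF bounded_linear_vec_nth f'(1)] in auto)
  qed
next
  assume ?R
  then obtain E where E: "\<And>i. ((\<lambda>x. f x $ i) has_derivative E i) (at x)" "\<And>i a v. E i (a *s v) = a * E i v"
    by metis
  have "(f has_derivative (\<lambda>v. \<chi> i. E i v)) (at x)"
    by (rule has_derivative_vecI) (use E(1) in simp)
  then show "cdiff_at f x"
    unfolding cdiff_at_def by (rule exI[of _ "\<lambda>v. \<chi> i. E i v", OF conjI]) (simp add: E(2) vec_eq_iff)
qed

lemma cdiff_at_linear:
  assumes "linear f" "\<And>a v. f (a *s v) = a *s f v"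
  shows "cdiff_at f x"
  unfolding cdiff_at_def
  using assms by (intro exI[of _ f]) (simp add: bounded_linear_imp_has_derivative linear_conv_bounded_linear)

lemma cdiff_at_ident: "cdiff_at (\<lambda>x. x) x"
  unfolding cdiff_at_def by (intro exI[of _ "\<lambda>x. x"]) simp

lemma cdiff_at_const: "cdiff_at (\<lambda>x. k) x"
  unfolding cdiff_at_def by (intro exI[of _ "\<lambda>x. 0"]) simp

text \<open>The hypothesis covers a whole neighbourhood because Cauchy's formula integrates
  \<open>f\<close> around \<open>x\<close>.\<close>

lemma cdiff_at_frechet_derivative:
  assumes "\<forall>\<^sub>F y in nhds x. cdiff_at f y"
  shows "cdiff_at (\<lambda>y. frechet_derivative f (at y) v) x"
proof -
  obtain S where S: "open S" "x \<in> S" "\<And>y. y \<in> S \<Longrightarrow> cdiff_at f y"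
    using assms unfolding eventually_nhds by blast
  show ?thesis
    unfolding cdiff_at_vec_iff
    by (intro allI holo_on_derivative_component[OF S(1) cdiff_at_has_derivative[OF S(3)] cdiff_at_smult[OF S(3)] S(2)])
qed

lemma eventually_compose_isCont:
  "isCont f x \<Longrightarrow> \<forall>\<^sub>F z in nhds (f x). P z \<Longrightarrow> \<forall>\<^sub>F y in nhds x. P (f y)"
  by (metis isCont_def eventually_compose_filterlim filterlim_iff tendsto_at_iff_tendsto_nhds)

text \<open>The coordinates of a pair in a product chart:
  \<open>coord (prod_chart c d) (p, q)\<close> is
  \<open>vjoin (coord c p) (coord d q)\<close>.\<close>

definition vjoin :: "complex^'m::finite \<Rightarrow> complex^'n::finite \<Rightarrow> complex^('m + 'n)" where
  "vjoin x y = (\<chi> k. case k of Inl i \<Rightarrow> x $ i | Inr j \<Rightarrow> y $ j)"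

lemma vjoin_nth [simp]: "vjoin x y $ Inl i = x $ i" "vjoin x y $ Inr j = y $ j"
  by (simp_all add: vjoin_def)

lemma vec_sum_eq_iff: "(x :: complex^('m::finite + 'n::finite)) = y \<longleftrightarrow>
    (\<forall>i. x $ Inl i = y $ Inl i) \<and> (\<forall>j. x $ Inr j = y $ Inr j)"
  unfolding vec_eq_iff by (metis sum.exhaust)

lemma cdiff_at_vjoin:
  assumes "cdiff_at f x" "cdiff_at g x"
  shows "cdiff_at (\<lambda>x. vjoin (f x) (g x)) x"
  unfolding cdiff_at_vec_iff
proof
  fix k
  show "\<exists>E. ((\<lambda>x. vjoin (f x) (g x) $ k) has_derivative E) (at x) \<and> (\<forall>a v. E (a *s v) = a * E v)"
    using assms unfolding cdiff_at_vec_iff by (cases k) simp_all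
qed

section \<open>Holomorphic parametrisations in a manifold\<close>

context complex_manifold
begin

lemma chart_inj: "c \<in> A \<Longrightarrow> inj_on (coord c) (dom c)"
  using charts[of c] openin_subset[of X "dom c"] unfolding is_chart_def
  by (auto dest!: homeomorphic_imp_injective_map simp: Int_absorb1)

lemma inv_coord_coord [simp]: "c \<in> A \<Longrightarrow> p \<in> dom c \<Longrightarrow> inv_coord c (coord c p) = p"
  unfolding inv_coord_def by (rule inv_into_f_f[OF chart_inj])

lemma inv_coord_in_dom [simp]: "z \<in> codom c \<Longrightarrow> inv_coord c z \<in> dom c"
  unfolding inv_coord_def by (rule inv_into_into)

lemma coord_inv_coord [simp]: "z \<in> codom c \<Longrightarrow> coord c (inv_coord c z) = z"
  unfolding inv_coord_def by (rule f_inv_into_f)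

lemma open_codom: "c \<in> A \<Longrightarrow> open (codom c)"
  using charts unfolding is_chart_def by blast

lemma openin_dom: "c \<in> A \<Longrightarrow> openin X (dom c)"
  using charts unfolding is_chart_def by blast

lemma dom_subset: "c \<in> A \<Longrightarrow> dom c \<subseteq> topspace X"
  using openin_dom openin_subset by blast

lemma open_coord_image:
  assumes "c \<in> A" "openin X V"
  shows "open (coord c ` (V \<inter> dom c))"
proof -
  have "open_map (subtopology X (dom c)) (top_of_set (codom c)) (coord c)"
    using charts[OF assms(1)] unfolding is_chart_def by (auto intro: homeomorphic_imp_open_map)
  moreover have "openin (subtopology X (dom c)) (V \<inter> dom c)"
    using assms(2) by (auto simp: openin_subtopology)
  ultimately show ?thesis
    using open_codom[OF assms(1)] unfolding open_map_def by (metis openin_open_trans)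
qed

lemma transition_cdiff_at:
  assumes "c \<in> A" "d \<in> A" "p \<in> dom c" "p \<in> dom d"
  shows "cdiff_at (\<lambda>z. coord d (inv_coord c z)) (coord c p)"
  using compat[OF assms(1,2)] assms(3,4) unfolding compatible_def holo_on_iff_cdiff_at
  by (auto simp: comp_def)

text \<open>All charts around \<open>u y\<close> are required, so that any of them can be used
  later. Staying in \<open>dom c\<close> near \<open>y\<close> makes the coordinate expression
  meaningful, and membership in \<open>topspace X\<close> excludes points in no chart, where the
  rest would be vacuous.\<close>

definition holo_into :: "(complex^'m::finite \<Rightarrow> 'a) \<Rightarrow> complex^'m \<Rightarrow> bool" where
  "holo_into u y \<longleftrightarrow> u y \<in> topspace X \<and>
     (\<forall>c\<in>A. u y \<in> dom c \<longrightarrow>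
        (\<forall>\<^sub>F x in nhds y. u x \<in> dom c) \<and> cdiff_at (\<lambda>x. coord c (u x)) y)"

lemma holo_into_topspace: "holo_into u y \<Longrightarrow> u y \<in> topspace X"
  by (simp add: holo_into_def)

lemma holo_into_dom: "holo_into u y \<Longrightarrow> c \<in> A \<Longrightarrow> u y \<in> dom c \<Longrightarrow> \<forall>\<^sub>F x in nhds y. u x \<in> dom c"
  by (simp add: holo_into_def)

lemma holo_into_coord: "holo_into u y \<Longrightarrow> c \<in> A \<Longrightarrow> u y \<in> dom c \<Longrightarrow> cdiff_at (\<lambda>x. coord c (u x)) y"
  by (simp add: holo_into_def)

text \<open>Recovers continuity of \<open>u\<close> from its coordinate expression: the chart image
  of \<open>V\<close> is open, and injectivity of the chart leads back to \<open>V\<close>.\<close>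

lemma eventually_in_openin:
  assumes c: "c \<in> A" and u: "\<forall>\<^sub>F x in nhds y. u x \<in> dom c" "cdiff_at (\<lambda>x. coord c (u x)) y"
    and V: "openin X V" "u y \<in> V"
  shows "\<forall>\<^sub>F x in nhds y. u x \<in> V"
proof -
  have "u y \<in> dom c" using u(1) by (rule eventually_nhds_x_imp_x)
  then have "coord c (u y) \<in> coord c ` (V \<inter> dom c)" using V(2) by blast
  then have "\<forall>\<^sub>F z in nhds (coord c (u y)). z \<in> coord c ` (V \<inter> dom c)"
    using open_coord_image[OF c V(1)] by (rule eventually_nhds_in_open[rotated])
  from eventually_compose_isCont[OF cdiff_at_isCont[OF u(2)] this] u(1)
  show ?thesis
  proof eventually_elim
    case (elim x)
    then obtain q where "q \<in> V" "q \<in> dom c" "coord c (u x) = coord c q" by blast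
    then show ?case using inj_onD[OF chart_inj[OF c]] elim(2) by metis
  qed
qed

text \<open>One chart suffices, because the coordinate changes are holomorphic.\<close>

lemma holo_intoI:
  assumes c: "c \<in> A" and u: "\<forall>\<^sub>F x in nhds y. u x \<in> dom c" "cdiff_at (\<lambda>x. coord c (u x)) y"
  shows "holo_into u y"
  unfolding holo_into_def
proof (intro conjI ballI impI)
  have uy: "u y \<in> dom c" using u(1) by (rule eventually_nhds_x_imp_x)
  then show "u y \<in> topspace X" using dom_subset[OF c] by blast
  fix d assume d: "d \<in> A" "u y \<in> dom d"
  show "\<forall>\<^sub>F x in nhds y. u x \<in> dom d"
    by (rule eventually_in_openin[OF c u openin_dom[OF d(1)] d(2)])
  show "cdiff_at (\<lambda>x. coord d (u x)) y"
  proof (rule cdiff_at_cong_eventually)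
    show "\<forall>\<^sub>F x in nhds y. coord d (inv_coord c (coord c (u x))) = coord d (u x)"
      using u(1) by eventually_elim (simp add: c)
    show "cdiff_at (\<lambda>x. coord d (inv_coord c (coord c (u x)))) y"
      by (rule cdiff_at_compose[OF u(2) transition_cdiff_at[OF c d(1) uy d(2)]])
  qed
qed

lemma obtain_chart:
  assumes "p \<in> topspace X"
  obtains c where "c \<in> A" "p \<in> dom c"
  using assms cover by auto

lemma holo_into_openin:
  assumes "holo_into u y" "openin X V" "u y \<in> V"
  shows "\<forall>\<^sub>F x in nhds y. u x \<in> V"
proof -
  obtain c where c: "c \<in> A" "u y \<in> dom c" using holo_into_topspace[OF assms(1)] obtain_chart by blast
  show ?thesis
    by (rule eventually_in_openin[OF c(1) holo_into_dom[OF assms(1) c] holo_into_coord[OF assms(1) c] assms(2,3)])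
qed

lemma holo_into_inv_coord:
  assumes "c \<in> A" "z \<in> codom c"
  shows "holo_into (inv_coord c) z"
proof (rule holo_intoI[OF assms(1)])
  have ev: "\<forall>\<^sub>F x in nhds z. x \<in> codom c"
    using open_codom[OF assms(1)] assms(2) by (rule eventually_nhds_in_open)
  then show "\<forall>\<^sub>F x in nhds z. inv_coord c x \<in> dom c" by eventually_elim simp
  show "cdiff_at (\<lambda>x. coord c (inv_coord c x)) z"
    by (rule cdiff_at_cong_eventually[OF _ cdiff_at_ident])
      (use ev in \<open>eventually_elim; simp\<close>)
qed

lemma holo_into_const:
  assumes "p \<in> topspace X"
  shows "holo_into (\<lambda>_. p) y"
proof -
  obtain c where "c \<in> A" "p \<in> dom c" using assms obtain_chart by blast
  then show ?thesis by (intro holo_intoI[of c] cdiff_at_const) auto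
qed

lemma holo_into_compose:
  assumes "holo_into u (g y)" "cdiff_at g y"
  shows "holo_into (\<lambda>x. u (g x)) y"
proof -
  obtain c where c: "c \<in> A" "u (g y) \<in> dom c" using holo_into_topspace[OF assms(1)] obtain_chart by blast
  show ?thesis
    by (rule holo_intoI[OF c(1) eventually_compose_isCont[OF cdiff_at_isCont[OF assms(2)] holo_into_dom[OF assms(1) c]]
          cdiff_at_compose[OF assms(2) holo_into_coord[OF assms(1) c]]])
qed

lemma holo_into_map:
  assumes f: "holomorphic_map X A X A f" and u: "holo_into u y"
  shows "holo_into (\<lambda>x. f (u x)) y"
proof -
  obtain c where c: "c \<in> A" "u y \<in> dom c" using holo_into_topspace[OF u] obtain_chart by blast
  have cont: "continuous_map X X f" using f by (simp add: holomorphic_map_def)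
  then have "f (u y) \<in> topspace X" using holo_into_topspace[OF u] by (auto simp: continuous_map_def)
  then obtain d where d: "d \<in> A" "f (u y) \<in> dom d" using obtain_chart by blast
  have "openin X {p \<in> topspace X. f p \<in> dom d}"
    using cont openin_dom[OF d(1)] by (simp add: continuous_map_def)
  from holo_into_openin[OF u this] d(2) holo_into_topspace[OF u]
  have ev: "\<forall>\<^sub>F x in nhds y. f (u x) \<in> dom d" by (auto elim: eventually_mono)
  have "cdiff_at (coord d \<circ> f \<circ> inv_coord c) (coord c (u y))"
    using f c d unfolding holomorphic_map_def holo_on_iff_cdiff_at by blast
  from cdiff_at_compose[OF holo_into_coord[OF u c] this]
  have "cdiff_at (\<lambda>x. (coord d \<circ> f \<circ> inv_coord c) (coord c (u x))) y" .
  then have "cdiff_at (\<lambda>x. coord d (f (u x))) y"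
    by (rule cdiff_at_cong_eventually[rotated])
      (use holo_into_dom[OF u c] in \<open>eventually_elim; simp add: c\<close>)
  with ev show ?thesis by (rule holo_intoI[OF d(1)])
qed

text \<open>The chain rule through an intermediate chart \<open>c\<close>. With \<open>h\<close> the
  identity it is the transformation law of tangent vectors; with \<open>h\<close> a left translation
  it computes pushforwards.\<close>

lemma frechet_derivative_chart_chain:
  assumes h: "\<And>z. z \<in> codom c \<Longrightarrow> holo_into (\<lambda>x. h (inv_coord c x)) z"
    and u: "holo_into u y" and c: "c \<in> A" "u y \<in> dom c" and d: "d \<in> A" "h (u y) \<in> dom d"
  shows "frechet_derivative (\<lambda>x. coord d (h (u x))) (at y) v =
    frechet_derivative (\<lambda>x. coord d (h (inv_coord c x))) (at (coord c (u y)))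
      (frechet_derivative (\<lambda>x. coord c (u x)) (at y) v)"
proof -
  have 1: "cdiff_at (\<lambda>x. coord c (u x)) y" by (rule holo_into_coord[OF u c])
  have 2: "cdiff_at (\<lambda>x. coord d (h (inv_coord c x))) (coord c (u y))"
    by (rule holo_into_coord[OF h d(1)]) (use c d in auto)
  have "frechet_derivative (\<lambda>x. coord d (h (inv_coord c (coord c (u x))))) (at y) =
      frechet_derivative (\<lambda>x. coord d (h (u x))) (at y)"
    by (rule frechet_derivative_cong_eventually[OF _ cdiff_at_compose[OF 1 2]])
      (use holo_into_dom[OF u c] in \<open>eventually_elim; simp add: c\<close>)
  then show ?thesis using frechet_derivative_chain[OF 1 2, of v] by simp
qed

section \<open>Induced coordinates on the tangent bundle\<close>

lemma of_coords_comp: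
  "d \<in> A \<Longrightarrow> inv_coord c z \<in> dom d \<Longrightarrow>
    snd (of_coords A c z w) d = frechet_derivative (\<lambda>x. coord d (inv_coord c x)) (at z) w"
  by (simp add: of_coords_def comp_def)

lemma of_coords_in_tangent_bundle:
  assumes c: "c \<in> A" and z: "z \<in> codom c"
  shows "of_coords A c z w \<in> tangent_bundle X A"
proof -
  have q: "inv_coord c z \<in> topspace X" using dom_subset[OF c] z by auto
  have chain: "frechet_derivative (coord d \<circ> inv_coord c) (at z) w =
      frechet_derivative (coord d \<circ> inv_coord e) (at (coord e (inv_coord c z)))
        (frechet_derivative (coord e \<circ> inv_coord c) (at z) w)"
    if "e \<in> A" "d \<in> A" "inv_coord c z \<in> dom e" "inv_coord c z \<in> dom d" for d e
    using frechet_derivative_chart_chain[of e "\<lambda>x. x" "inv_coord c" z d w] that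
      holo_into_inv_coord[OF c z] holo_into_inv_coord[OF that(1)]
    by (simp add: comp_def)
  have "snd (of_coords A c z w) \<in> tangent_space A (inv_coord c z)"
    unfolding tangent_space_def of_coords_def snd_conv
  proof (intro CollectI conjI allI ballI impI)
    fix e d assume "e \<in> A" "d \<in> A" "inv_coord c z \<in> dom e \<inter> dom d"
    then show "(if d \<in> A \<and> inv_coord c z \<in> dom d then frechet_derivative (coord d \<circ> inv_coord c) (at z) w else 0) =
        frechet_derivative (coord d \<circ> inv_coord e) (at (coord e (inv_coord c z)))
          (if e \<in> A \<and> inv_coord c z \<in> dom e then frechet_derivative (coord e \<circ> inv_coord c) (at z) w else 0)"
      by (simp only: Int_iff if_True simp_thms chain[symmetric])
  qed (simp only: if_False)
  then show ?thesis
    using q by (simp add: tangent_bundle_def of_coords_def)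
qed

lemma frechet_derivative_coord_inv_coord:
  assumes c: "c \<in> A" and z: "z \<in> codom c"
  shows "frechet_derivative (\<lambda>x. coord c (inv_coord c x)) (at z) w = w"
proof -
  have "\<forall>\<^sub>F x in nhds z. x \<in> codom c"
    using open_codom[OF c] z by (rule eventually_nhds_in_open)
  then have "\<forall>\<^sub>F x in nhds z. x = coord c (inv_coord c x)" by eventually_elim simp
  from frechet_derivative_cong_eventually[OF this cdiff_at_ident] show ?thesis by (metis frechet_derivative_ident)
qed

lemma of_coords_in_slit_tangent_bundle:
  assumes c: "c \<in> A" and z: "z \<in> codom c" and w: "w \<noteq> 0"
  shows "of_coords A c z w \<in> slit_tangent_bundle X A"
proof -
  have "snd (of_coords A c z w) c \<noteq> 0"
    using w by (simp add: of_coords_comp c z frechet_derivative_coord_inv_coord)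
  then show ?thesis
    using of_coords_in_tangent_bundle[OF c z, of w] unfolding slit_tangent_bundle_def
    by (cases "of_coords A c z w") auto
qed

lemma of_coords_smult:
  assumes c: "c \<in> A" and z: "z \<in> codom c"
  shows "of_coords A c z (a *s w) = (fst (of_coords A c z w), \<lambda>d. a *s snd (of_coords A c z w) d)"
proof -
  have "frechet_derivative (coord d \<circ> inv_coord c) (at z) (a *s w) =
      a *s frechet_derivative (coord d \<circ> inv_coord c) (at z) w" if "d \<in> A" "inv_coord c z \<in> dom d" for d
    using cdiff_at_smult[OF holo_into_coord[OF holo_into_inv_coord[OF c z] that]] by (simp add: comp_def)
  then show ?thesis by (auto simp: of_coords_def)
qed

text \<open>The transformation law is linear, so a zero component in one chart around
  \<open>p\<close> forces zero in all of them; at other charts the value is 0 by convention.\<close>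

lemma slit_tangent_vector_coords_nonzero:
  assumes pv: "(p, v) \<in> slit_tangent_bundle X A" and c: "c \<in> A" "p \<in> dom c"
  shows "v c \<noteq> 0"
proof
  assume "v c = 0"
  have v: "v \<in> tangent_space A p" "v \<noteq> (\<lambda>_. 0)"
    using pv by (auto simp: slit_tangent_bundle_def tangent_bundle_def)
  have "v d = 0" for d
  proof (cases "d \<in> A \<and> p \<in> dom d")
    case True
    have "\<forall>c\<in>A. \<forall>d\<in>A. p \<in> dom c \<inter> dom d \<longrightarrow>
        v d = frechet_derivative (coord d \<circ> inv_coord c) (at (coord c p)) (v c)"
      using v(1) unfolding tangent_space_def by blast
    then have "v d = frechet_derivative (\<lambda>x. coord d (inv_coord c x)) (at (coord c p)) (v c)"
      using c True unfolding comp_def by blast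
    also have "\<dots> = 0"
      using linear_0[OF has_derivative_linear[OF cdiff_at_has_derivative[OF transition_cdiff_at]]] c True
      by (simp add: \<open>v c = 0\<close>)
    finally show ?thesis .
  next
    case False
    then show ?thesis using v(1) by (auto simp: tangent_space_def)
  qed
  then show False using v(2) by blast
qed

end

section \<open>Left translations\<close>

context complex_lie_group
begin

text \<open>Ensures that \<open>inv_coord\<close>, an \<open>inv_into\<close>, really inverts a
  product chart on its domain; \<open>chart_inj\<close> speaks only of the charts in
  \<open>A\<close>.\<close>

lemma inj_prod_chart:
  assumes "c \<in> A" "d \<in> A"
  shows "inj_on (coord (prod_chart c d)) (dom c \<times> dom d)"
proof (rule inj_onI)
  fix x y assume xy: "x \<in> dom c \<times> dom d" "y \<in> dom c \<times> dom d"
    "coord (prod_chart c d) x = coord (prod_chart c d) y"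
  obtain p q p' q' where [simp]: "x = (p, q)" "y = (p', q')" by (metis surj_pair)
  have "vjoin (coord c p) (coord d q) = vjoin (coord c p') (coord d q')"
    using xy(3) by (simp add: prod_chart_def vjoin_def)
  then have "coord c p = coord c p'" "coord d q = coord d q'"
    by (simp_all add: vec_sum_eq_iff vec_eq_iff)
  then show "x = y"
    using xy(1,2) chart_inj[OF assms(1)] chart_inj[OF assms(2)] by (auto dest: inj_onD)
qed

text \<open>Turns holomorphy of the multiplication on the product manifold into a rule for products
  of parametrisations.\<close>

lemma holo_into_mult:
  assumes u: "holo_into u y" and v: "holo_into v y"
  shows "holo_into (\<lambda>x. u x \<otimes> v x) y"
proof -
  let ?m = "\<lambda>(g, h). g \<otimes> h"
  obtain c where c: "c \<in> A" "u y \<in> dom c" using holo_into_topspace[OF u] obtain_chart by blast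
  obtain d where d: "d \<in> A" "v y \<in> dom d" using holo_into_topspace[OF v] obtain_chart by blast
  have "u y \<otimes> v y \<in> topspace X"
    using holo_into_topspace[OF u] holo_into_topspace[OF v] carrier m_closed by metis
  then obtain e where e: "e \<in> A" "u y \<otimes> v y \<in> dom e" using obtain_chart by blast
  have cont: "continuous_map (prod_topology X X) X ?m"
    using mult_holomorphic by (simp add: holomorphic_map_def)
  define W where "W = {x \<in> topspace (prod_topology X X). ?m x \<in> dom e}"
  have W: "openin (prod_topology X X) W"
    unfolding W_def using cont openin_dom[OF e(1)] by (rule openin_continuous_map_preimage)
  have "(u y, v y) \<in> W"
    using e(2) holo_into_topspace[OF u] holo_into_topspace[OF v] by (simp add: W_def)
  \<comment> \<open>An open box inside the preimage of \<open>dom e\<close> lets the two factors be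
    controlled separately.\<close>
  then have "\<exists>U V. openin X U \<and> openin X V \<and> u y \<in> U \<and> v y \<in> V \<and> U \<times> V \<subseteq> W"
    by (rule openin_prod_topology_alt[THEN iffD1, OF W, rule_format])
  then obtain U V where UV: "openin X U" "openin X V" "u y \<in> U" "v y \<in> V" "U \<times> V \<subseteq> W"
    by (elim exE conjE)
  have ev: "\<forall>\<^sub>F x in nhds y. u x \<otimes> v x \<in> dom e"
    using holo_into_openin[OF u UV(1,3)] holo_into_openin[OF v UV(2,4)]
    by eventually_elim (use UV(5) in \<open>auto simp: W_def\<close>)
  let ?pc = "prod_chart c d"
  let ?j = "\<lambda>x. vjoin (coord c (u x)) (coord d (v x))"
  have coord_pc: "coord ?pc (p, q) = vjoin (coord c p) (coord d q)" for p q
    by (simp add: prod_chart_def vjoin_def)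
  have dom_pc: "dom ?pc = dom c \<times> dom d" by (simp add: prod_chart_def)
  have inv_pc: "inv_coord ?pc (vjoin (coord c p) (coord d q)) = (p, q)" if "p \<in> dom c" "q \<in> dom d" for p q
    unfolding inv_coord_def coord_pc[symmetric] dom_pc
    by (rule inv_into_f_f[OF inj_prod_chart[OF c(1) d(1)]]) (use that in auto)
  have "holo_on (coord ?pc ` {x \<in> dom ?pc. ?m x \<in> dom e}) (coord e \<circ> ?m \<circ> inv_coord ?pc)"
    using mult_holomorphic c(1) d(1) e(1) unfolding holomorphic_map_def prod_atlas_def by blast
  moreover have "?j y \<in> coord ?pc ` {x \<in> dom ?pc. ?m x \<in> dom e}"
    using c d e by (auto simp: dom_pc coord_pc intro!: image_eqI[of _ _ "(u y, v y)"])
  ultimately have "cdiff_at (coord e \<circ> ?m \<circ> inv_coord ?pc) (?j y)"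
    unfolding holo_on_iff_cdiff_at by blast
  from cdiff_at_compose[OF cdiff_at_vjoin[OF holo_into_coord[OF u c] holo_into_coord[OF v d]] this]
  have "cdiff_at (\<lambda>x. (coord e \<circ> ?m \<circ> inv_coord ?pc) (?j x)) y" .
  moreover have "\<forall>\<^sub>F x in nhds y. (coord e \<circ> ?m \<circ> inv_coord ?pc) (?j x) = coord e (u x \<otimes> v x)"
    using holo_into_dom[OF u c] holo_into_dom[OF v d] by eventually_elim (simp add: inv_pc)
  ultimately have "cdiff_at (\<lambda>x. coord e (u x \<otimes> v x)) y"
    by (rule cdiff_at_cong_eventually[rotated])
  with ev show ?thesis by (rule holo_intoI[OF e(1)])
qed

lemma holo_into_inv: "holo_into u y \<Longrightarrow> holo_into (\<lambda>x. inv (u x)) y"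
  using holo_into_map[OF inv_holomorphic] .

lemma holo_into_left_translation:
  "g \<in> carrier G \<Longrightarrow> holo_into u y \<Longrightarrow> holo_into (\<lambda>x. g \<otimes> u x) y"
  by (rule holo_into_mult[OF holo_into_const]) (simp_all add: carrier)

text \<open>\<open>pushforward\<close> is computed in an arbitrarily chosen chart \<open>e\<close>;
  the chain rule replaces it by \<open>c\<close>.\<close>

lemma pushforward_of_coords:
  assumes g: "g \<in> carrier G" and c: "c \<in> A" and z: "z \<in> codom c"
    and gz: "g \<otimes> inv_coord c z \<in> dom c"
  shows "pushforward A A (\<lambda>h. g \<otimes> h) (of_coords A c z w) =
    of_coords A c (coord c (g \<otimes> inv_coord c z))
      (frechet_derivative (\<lambda>x. coord c (g \<otimes> inv_coord c x)) (at z) w)"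
proof -
  let ?q = "inv_coord c z"
  define e where "e = (SOME c. c \<in> A \<and> ?q \<in> dom c)"
  have "\<exists>c. c \<in> A \<and> ?q \<in> dom c" using c z by auto
  then have e: "e \<in> A" "?q \<in> dom e"
    unfolding e_def using someI_ex[of "\<lambda>c. c \<in> A \<and> ?q \<in> dom c"] by auto
  have ic: "holo_into (inv_coord c) x" if "x \<in> codom c" for x by (rule holo_into_inv_coord[OF c that])
  have ie: "holo_into (\<lambda>x. g \<otimes> inv_coord e x) x" if "x \<in> codom e" for x
    by (rule holo_into_left_translation[OF g holo_into_inv_coord[OF e(1) that]])
  have gc: "holo_into (\<lambda>x. g \<otimes> inv_coord c x) z" by (rule holo_into_left_translation[OF g ic[OF z]])
  \<comment> \<open>Both sides equal the derivative of
    \<open>coord d (g \<otimes> inv_coord c x)\<close> at \<open>x = z\<close>, factored once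
    through \<open>e\<close> and once through \<open>c\<close>.\<close>
  have 1: "frechet_derivative (\<lambda>x. coord d (g \<otimes> inv_coord e x)) (at (coord e ?q))
        (frechet_derivative (\<lambda>x. coord e (inv_coord c x)) (at z) w) =
      frechet_derivative (\<lambda>x. coord d (inv_coord c x)) (at (coord c (g \<otimes> ?q)))
        (frechet_derivative (\<lambda>x. coord c (g \<otimes> inv_coord c x)) (at z) w)"
    if d: "d \<in> A" "g \<otimes> ?q \<in> dom d" for d
    using frechet_derivative_chart_chain[OF ie ic[OF z] e d, of w]
      frechet_derivative_chart_chain[of c "\<lambda>x. x", OF ic gc c gz d, of w] by simp
  have "pushforward A A (\<lambda>h. g \<otimes> h) (of_coords A c z w) =
      (g \<otimes> ?q, \<lambda>d. if d \<in> A \<and> g \<otimes> ?q \<in> dom d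
        then frechet_derivative (\<lambda>x. coord d (g \<otimes> inv_coord e x)) (at (coord e ?q))
          (frechet_derivative (\<lambda>x. coord e (inv_coord c x)) (at z) w) else 0)"
    by (simp add: pushforward_def of_coords_def e_def[symmetric] Let_def comp_def e cong: if_cong)
  also have "\<dots> = of_coords A c (coord c (g \<otimes> ?q))
      (frechet_derivative (\<lambda>x. coord c (g \<otimes> inv_coord c x)) (at z) w)"
    unfolding of_coords_def inv_coord_coord[OF c gz] comp_def prod.inject
  proof (intro conjI refl ext)
    fix d
    show "(if d \<in> A \<and> g \<otimes> ?q \<in> dom d
          then frechet_derivative (\<lambda>x. coord d (g \<otimes> inv_coord e x)) (at (coord e ?q))
            (frechet_derivative (\<lambda>x. coord e (inv_coord c x)) (at z) w) else 0) =
        (if d \<in> A \<and> g \<otimes> ?q \<in> dom d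
          then frechet_derivative (\<lambda>x. coord d (inv_coord c x)) (at (coord c (g \<otimes> ?q)))
            (frechet_derivative (\<lambda>x. coord c (g \<otimes> inv_coord c x)) (at z) w) else 0)"
      by (cases "d \<in> A \<and> g \<otimes> ?q \<in> dom d") (simp_all only: 1 if_True if_False simp_thms)
  qed
  finally show ?thesis .
qed

text \<open>The differential \<open>B z\<close> of the overview: the translating element depends on
  \<open>z\<close> but stays fixed while \<open>x\<close> is differentiated, and only then is
  \<open>x = z\<close> inserted.\<close>

definition translate :: "('a, 'n) chart \<Rightarrow> 'a \<Rightarrow> complex^'n \<Rightarrow> complex^'n \<Rightarrow> complex^'n" where
  "translate c p z = frechet_derivative (\<lambda>x. coord c (p \<otimes> inv (inv_coord c z) \<otimes> inv_coord c x)) (at z)"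

context
  fixes c p
  assumes c: "c \<in> A" and p: "p \<in> dom c"
begin

lemma p_carrier: "p \<in> carrier G"
  using dom_subset[OF c] p carrier by auto

lemma inv_coord_carrier: "z \<in> codom c \<Longrightarrow> inv_coord c z \<in> carrier G"
  using dom_subset[OF c] carrier by (metis inv_coord_in_dom subsetD)

lemma translate_base_point: "z \<in> codom c \<Longrightarrow> p \<otimes> inv (inv_coord c z) \<otimes> inv_coord c z = p"
  using p_carrier inv_coord_carrier by (simp add: m_assoc)

lemma translate_cdiff_at:
  assumes z: "z \<in> codom c"
  shows "cdiff_at (\<lambda>x. coord c (p \<otimes> inv (inv_coord c z) \<otimes> inv_coord c x)) z"
  by (rule holo_into_coord[OF holo_into_left_translation[OF _ holo_into_inv_coord[OF c z]] c])
    (use translate_base_point[OF z] p inv_coord_carrier[OF z] p_carrier in auto)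

lemma linear_translate: "z \<in> codom c \<Longrightarrow> linear (translate c p z)"
  unfolding translate_def by (rule has_derivative_linear[OF cdiff_at_has_derivative[OF translate_cdiff_at]])

lemma translate_smult: "z \<in> codom c \<Longrightarrow> translate c p z (a *s w) = a *s translate c p z w"
  unfolding translate_def by (rule cdiff_at_smult[OF translate_cdiff_at])

text \<open>At \<open>z = coord c p\<close> the translating element is the unit, so the map is the
  identity near this point.\<close>

lemma translate_at_p: "translate c p (coord c p) w = w"
proof -
  have z: "coord c p \<in> codom c" using p by blast
  have "\<forall>\<^sub>F x in nhds (coord c p). x \<in> codom c"
    using open_codom[OF c] z by (rule eventually_nhds_in_open)
  then have "\<forall>\<^sub>F x in nhds (coord c p). x = coord c (p \<otimes> inv (inv_coord c (coord c p)) \<otimes> inv_coord c x)"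
    by eventually_elim (simp add: c p p_carrier inv_coord_carrier r_inv)
  from frechet_derivative_cong_eventually[OF this cdiff_at_ident] show ?thesis
    unfolding translate_def by (metis frechet_derivative_ident)
qed

text \<open>\<open>translate c p z w\<close> is a partial derivative, along the diagonal, of the holomorphic map
  \<open>(z, x) \<mapsto> p z\<^sup>-\<^sup>1 x\<close> on \<open>\<complex>\<^sup>n\<^sup>+\<^sup>n\<close>.\<close>

lemma holo_on_translate: "holo_on (codom c) (\<lambda>z. translate c p z w)"
  unfolding holo_on_iff_cdiff_at
proof
  fix z assume z: "z \<in> codom c"
  define p1 p2 :: "complex^('n + 'n) \<Rightarrow> complex^'n"
    where "p1 = (\<lambda>x. \<chi> i. x $ Inl i)" and "p2 = (\<lambda>x. \<chi> i. x $ Inr i)"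
  have cp: "cdiff_at p1 x" "cdiff_at p2 x" for x
    by (rule cdiff_at_linear; (rule linearI)?; simp add: p1_def p2_def vec_eq_iff)+
  have p12 [simp]: "p1 (vjoin x y) = x" "p2 (vjoin x y) = y" for x y
    by (simp_all add: p1_def p2_def vec_eq_iff)
  define \<Phi> where "\<Phi> = (\<lambda>x. p \<otimes> inv (inv_coord c (p1 x)) \<otimes> inv_coord c (p2 x))"
  have \<Phi>: "holo_into \<Phi> x" if "p1 x \<in> codom c" "p2 x \<in> codom c" for x
    unfolding \<Phi>_def using p_carrier carrier that
    by (intro holo_into_mult holo_into_inv holo_into_const holo_into_compose[OF holo_into_inv_coord[OF c]] cp) auto
  let ?k = "\<lambda>x. coord c (\<Phi> x)"
  let ?S = "{x. p1 x \<in> codom c \<and> p2 x \<in> codom c \<and> \<Phi> x \<in> dom c}"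
  have k: "cdiff_at ?k x" if "x \<in> ?S" for x
    by (rule holo_into_coord[OF \<Phi> c]) (use that in auto)
  have jS: "vjoin x x \<in> ?S" if "x \<in> codom c" for x
    using that translate_base_point[OF that] p by (simp add: \<Phi>_def)
  have "\<forall>\<^sub>F x in nhds (vjoin z z). p1 x \<in> codom c"
    by (rule eventually_compose_isCont[OF cdiff_at_isCont[OF cp(1)]])
      (use open_codom[OF c] z in \<open>auto intro: eventually_nhds_in_open\<close>)
  moreover have "\<forall>\<^sub>F x in nhds (vjoin z z). p2 x \<in> codom c"
    by (rule eventually_compose_isCont[OF cdiff_at_isCont[OF cp(2)]])
      (use open_codom[OF c] z in \<open>auto intro: eventually_nhds_in_open\<close>)
  moreover have "\<forall>\<^sub>F x in nhds (vjoin z z). \<Phi> x \<in> dom c"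
    by (rule holo_into_dom[OF \<Phi> c]) (use jS[OF z] in auto)
  ultimately have "\<forall>\<^sub>F x in nhds (vjoin z z). cdiff_at ?k x"
    by eventually_elim (rule k, blast)
  \<comment> \<open>The direction \<open>vjoin 0 w\<close> moves only the second variable. The
    derivative is holomorphic in both variables, and restricting to the diagonal afterwards gives
    \<open>translate c p z w\<close>.\<close>
  then have 1: "cdiff_at (\<lambda>x. frechet_derivative ?k (at x) (vjoin 0 w)) (vjoin z z)"
    by (rule cdiff_at_frechet_derivative)
  have "cdiff_at (\<lambda>x. vjoin x x) z" by (rule cdiff_at_vjoin[OF cdiff_at_ident cdiff_at_ident])
  from cdiff_at_compose[OF this 1]
  have 2: "cdiff_at (\<lambda>x. frechet_derivative ?k (at (vjoin x x)) (vjoin 0 w)) z" .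
  have eq: "frechet_derivative ?k (at (vjoin x x)) (vjoin 0 w) = translate c p x w" if x: "x \<in> codom c" for x
  proof -
    have "((\<lambda>y. vjoin x y) has_derivative (\<lambda>v. vjoin 0 v)) (at x)"
    proof (rule has_derivative_vecI)
      fix k show "((\<lambda>y. vjoin x y $ k) has_derivative (\<lambda>v. vjoin 0 v $ k)) (at x)"
        by (cases k) (auto intro!: derivative_eq_intros bounded_linear_imp_has_derivative)
    qed
    from has_derivative_compose[OF this cdiff_at_has_derivative[OF k[OF jS[OF x]]]]
    have "((\<lambda>y. coord c (p \<otimes> inv (inv_coord c x) \<otimes> inv_coord c y)) has_derivative
        (\<lambda>v. frechet_derivative ?k (at (vjoin x x)) (vjoin 0 v))) (at x)"
      unfolding \<Phi>_def p12 .
    from frechet_derivative_at[OF this] show ?thesis unfolding translate_def by metis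
  qed
  have "\<forall>\<^sub>F x in nhds z. x \<in> codom c"
    using open_codom[OF c] z by (rule eventually_nhds_in_open)
  then have "\<forall>\<^sub>F x in nhds z. frechet_derivative ?k (at (vjoin x x)) (vjoin 0 w) = translate c p x w"
    by eventually_elim (rule eq)
  then show "cdiff_at (\<lambda>x. translate c p x w) z" using 2 by (rule cdiff_at_cong_eventually)
qed

text \<open>Invariance is applied to a translation depending on \<open>z\<close>, namely the one
  taking \<open>inv_coord c z\<close> to \<open>p\<close>.\<close>

lemma left_invariant_translate:
  assumes F: "left_invariant X A G F" and z: "z \<in> codom c"
  shows "F (of_coords A c z w) = F (of_coords A c (coord c p) (translate c p z w))"
proof -
  let ?g = "p \<otimes> inv (inv_coord c z)"
  have g: "?g \<in> carrier G" using p_carrier inv_coord_carrier[OF z] by simp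
  have gz: "?g \<otimes> inv_coord c z = p" by (rule translate_base_point[OF z])
  have "F (of_coords A c z w) = F (pushforward A A (\<lambda>h. ?g \<otimes> h) (of_coords A c z w))"
    using F g of_coords_in_tangent_bundle[OF c z, of w] unfolding left_invariant_def by metis
  also have "\<dots> = F (of_coords A c (coord c p) (translate c p z w))"
    using pushforward_of_coords[OF g c z, of w] p by (simp add: gz translate_def)
  finally show ?thesis .
qed

end

text \<open>The coordinate computation is applied with \<open>B = translate c p\<close> and
  \<open>z0 = coord c p\<close>, in an arbitrary chart \<open>c\<close> around the base point
  \<open>p\<close> of the given vector.\<close>

lemma hol_sect_curv_left_invariant:
  assumes F: "complex_finsler_metric X A F" and inv: "left_invariant X A G F"
    and pv: "(p, v) \<in> slit_tangent_bundle X A" and c: "c \<in> A" "p \<in> dom c"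
  shows "hol_sect_curv A F c (p, v) = 0"
proof -
  let ?GG = "sq_coord A F c"
  have z0: "coord c p \<in> codom c" using c by blast
  have hom: "?GG z (a *s w) = complex_of_real ((cmod a)\<^sup>2) * ?GG z w" if z: "z \<in> codom c" for z w a
  proof -
    have "\<forall>(p, v) \<in> tangent_bundle X A. \<forall>a. F (p, \<lambda>c. a *s v c) = cmod a * F (p, v)"
      using F by (simp add: complex_finsler_metric_def)
    then have "F (of_coords A c z (a *s w)) = cmod a * F (of_coords A c z w)"
      using of_coords_in_tangent_bundle[OF c(1) z, of w] unfolding of_coords_smult[OF c(1) z]
      by (cases "of_coords A c z w") auto
    then show ?thesis by (simp add: sq_coord_def power_mult_distrib)
  qed
  have pos: "?GG z w \<noteq> 0" if "z \<in> codom c" "w \<noteq> 0" for z w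
    using of_coords_in_slit_tangent_bundle[OF c(1) that] F
    by (auto simp: complex_finsler_metric_def sq_coord_def)
  have GG_translate: "?GG z w = ?GG (coord c p) (translate c p z w)" if "z \<in> codom c" for z w
    using left_invariant_translate[OF c inv that] by (simp add: sq_coord_def)
  let ?f = "\<lambda>(z, w). F (of_coords A c z w)"
  have f: "smooth_on (codom c \<times> (- {0})) ?f"
    using F c(1) unfolding complex_finsler_metric_def by blast
  have S: "open (codom c \<times> (- {0 :: complex^'n}))"
    using open_codom[OF c(1)] by (intro open_Times) (simp_all add: open_Compl)
  have GG_eq: "(\<lambda>(z, w). ?GG z w) = (\<lambda>x. complex_of_real (?f x * ?f x))"
    by (simp add: fun_eq_iff sq_coord_def power2_eq_square)
  have smooth: "smooth_on (codom c \<times> (- {0})) (\<lambda>(z, w). ?GG z w)"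
    unfolding GG_eq by (rule smooth_on_bounded_linear[OF S bounded_linear_of_real smooth_on_mult[OF S f f]])
  have pd: "pos_def (hess ?GG z w)" if "z \<in> codom c" "w \<noteq> 0" for z w
    using F c(1) that unfolding complex_finsler_metric_def by blast
  \<comment> \<open>Nonvanishing follows from the metric: by invariance, a nonzero vector sent to 0
    would have length 0.\<close>
  have translate_ne: "translate c p z w \<noteq> 0" if z: "z \<in> codom c" and w: "w \<noteq> 0" for z w
  proof
    assume "translate c p z w = 0"
    \<comment> \<open>Writing the zero vector as \<open>0 *s 0\<close> lets homogeneity with
      \<open>a = 0\<close> give the value 0.\<close>
    then have "?GG z w = ?GG (coord c p) (0 *s 0)" using GG_translate[OF z] by simp
    also have "\<dots> = 0" unfolding hom[OF z0] by simp
    finally show False using pos[OF z w] by simp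
  qed
  have "hol_sect_curv_coord ?GG (coord c p) (v c) = 0"
    by (rule hol_sect_curv_coord_eq_0[where B="translate c p", OF open_codom[OF c(1)] z0
          slit_tangent_vector_coords_nonzero[OF pv c] smooth _ hom pd holo_on_translate[OF c]
          linear_translate[OF c] translate_smult[OF c] translate_ne translate_at_p[OF c] GG_translate])
      (simp add: sq_coord_def)
  then show ?thesis by (simp add: hol_sect_curv_def)
qed

end

theorem theorem1p4:
  fixes X :: "'a topology" and A :: "('a, 'n::finite) chart set"
    and G :: "('a, 'b) monoid_scheme"
    and F :: "'a \<times> ('a, 'n) tvec \<Rightarrow> real"
  assumes "complex_lie_group X A G"
    and "complex_finsler_metric X A F"
    and "left_invariant X A G F"
  shows "\<forall>(p, v) \<in> slit_tangent_bundle X A. \<forall>c\<in>A. p \<in> dom c \<longrightarrow>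
           hol_sect_curv A F c (p, v) = 0"
  using complex_lie_group.hol_sect_curv_left_invariant[OF assms] by blast

end
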